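(* For each integer $k \geq 0$, the rooted graphs that are minimal minors for $\xi\xi(G,i) \geq 2k+1$ are exactly those rooted graphs obtained from the minimal minors for $\xi\xi(G,i) \geq 2k$ by extending their roots.
   Context: All graphs are finite and simple. For a graph $G$ on $n$ vertices labeled $1,\dots,n$, $\mathcal{S}(G)$ denotes the set of $n\times n$ real symmetric matrices whose off-diagonal $(j,k)$-entry is nonzero iff $\{j,k\}\in E(G)$ (diagonal arbitrary). $A(i)$ is $A$ with row and column $i$ deleted; $(AX)(i,:]$ is $AX$ with row $i$ deleted. The $i$-nullity pair of $A$ is $(\operatorname{null}(A),\operatorname{null}(A(i)))$. $\circ$ is the entrywise product. A real symmetric $A$ has $i$-SNIP if the only real symmetric $X$ with $A\circ X=O$, $I\circ X=O$, $(AX)(i,:]=O$ is $X=O$. A rooted graph $(G,i)$ is a graph with a designated root vertex $i$. $(G,i)$ allows the nullity pair $(k,\ell)$ with $i$-SNIP if some $A\in\mathcal{S}(G)$ with $i$-SNIP has $i$-nullity pair $(k,\ell)$. $\xi\xi(G,i)$ is the maximum of $k+\ell$ over pairs $(k,\ell)$ with $k\le \ell$ that $(G,i)$ allows with $i$-SNIP. A rooted minor of $(G,i)$ is a rooted graph obtained by a sequence of the operations: deleting an edge, deleting a non-root vertex, contracting an edge (the merged vertex becomes the root if the contracted edge is incident to the root); it is proper if it is not $(G,i)$ itself. $(G,i)$ is a minimal minor for $\xi\xi(G,i)\ge s$ if $\xi\xi(G,i)\ge s$ and every proper rooted minor $(F,j)$ of $(G,i)$ has $\xi\xi(F,j) <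 s$ (rooted graphs considered up to root-preserving isomorphism). A rooted graph $(G,i)$ is obtained from $(H,j)$ by extending the root if $G$ is obtained from $H$ by adding a new vertex $i$ adjacent only to $j$, and $i$ is the root. *)

theory Defs
  imports Complex_Main "HOL-Library.Function_Algebras"
begin

text \<open>
  A real matrix with rows and columns indexed by a finite set \<open>V\<close> is a function
  \<open>'a \<Rightarrow> 'a \<Rightarrow> real\<close> of which only the entries in \<open>V \<times> V\<close> are ever inspected.
  Hence the principal submatrix \<open>A(i)\<close> is the same function, indexed by \<open>V - {i}\<close>.
\<close>

type_synonym 'a matrix = "'a \<Rightarrow> 'a \<Rightarrow> real"

global_interpretation fun_vs: vector_space "\<lambda>(c::real) (x::'a \<Rightarrow> real) v. c * x v"
  by unfold_locales (auto simp: fun_eq_iff algebra_simps)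

definition kernel_on :: "'a set \<Rightarrow> 'a matrix \<Rightarrow> ('a \<Rightarrow> real) set" where
  "kernel_on V A = {x. (\<forall>v. v \<notin> V \<longrightarrow> x v = 0) \<and> (\<forall>u\<in>V. (\<Sum>v\<in>V. A u v * x v) = 0)}"

definition nullity :: "'a set \<Rightarrow> 'a matrix \<Rightarrow> nat" where
  "nullity V A = fun_vs.dim (kernel_on V A)"

definition symmetric_on :: "'a set \<Rightarrow> 'a matrix \<Rightarrow> bool" where
  "symmetric_on V A \<longleftrightarrow> (\<forall>u\<in>V. \<forall>v\<in>V. A u v = A v u)"

definition zero_on :: "'a set \<Rightarrow> 'a set \<Rightarrow> 'a matrix \<Rightarrow> bool" where
  "zero_on R C A \<longleftrightarrow> (\<forall>u\<in>R. \<forall>v\<in>C. A u v = 0)"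

definition id_matrix :: "'a matrix" where
  "id_matrix = (\<lambda>u v. if u = v then 1 else 0)"

definition entrywise_prod :: "'a matrix \<Rightarrow> 'a matrix \<Rightarrow> 'a matrix" where
  "entrywise_prod A B = (\<lambda>u v. A u v * B u v)"

definition matrix_prod_on :: "'a set \<Rightarrow> 'a matrix \<Rightarrow> 'a matrix \<Rightarrow> 'a matrix" where
  "matrix_prod_on V A B = (\<lambda>u v. \<Sum>w\<in>V. A u w * B w v)"

definition SNIP :: "'a set \<Rightarrow> 'a \<Rightarrow> 'a matrix \<Rightarrow> bool" where
  "SNIP V i A \<longleftrightarrow> symmetric_on V A \<and>
     (\<forall>X. symmetric_on V X \<and>
          zero_on V V (entrywise_prod A X) \<and>
          zero_on V V (entrywise_prod id_matrix X) \<and>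
          zero_on (V - {i}) V (matrix_prod_on V A X)
        \<longrightarrow> zero_on V V X)"

record 'a rooted_graph =
  verts :: "'a set"
  edges :: "'a set set"
  root :: 'a

definition rooted_graph :: "'a rooted_graph \<Rightarrow> bool" where
  "rooted_graph G \<longleftrightarrow> finite (verts G) \<and> (\<forall>e\<in>edges G. e \<subseteq> verts G \<and> card e = 2) \<and> root G \<in> verts G"

definition sym_matrices :: "'a rooted_graph \<Rightarrow> 'a matrix set" where
  "sym_matrices G = {A. symmetric_on (verts G) A \<and>
     (\<forall>u\<in>verts G. \<forall>v\<in>verts G. u \<noteq> v \<longrightarrow> (A u v \<noteq> 0 \<longleftrightarrow> {u, v} \<in> edges G))}"

definition allows_with_SNIP :: "'a rooted_graph \<Rightarrow> nat \<Rightarrow> nat \<Rightarrow> bool" where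
  "allows_with_SNIP G k l \<longleftrightarrow>
     (\<exists>A\<in>sym_matrices G. SNIP (verts G) (root G) A \<and>
        nullity (verts G) A = k \<and> nullity (verts G - {root G}) A = l)"

text \<open>
  For a rooted graph the maximum is over a finite set (nullities are at most the number of
  vertices) that contains 0: if \<open>A\<close> and \<open>A(i)\<close> are both invertible, then \<open>A\<close> has the \<open>i\<close>-SNIP.
\<close>

definition xixi :: "'a rooted_graph \<Rightarrow> nat" where
  "xixi G = Max {k + l | k l. k \<le> l \<and> allows_with_SNIP G k l}"

text \<open>
  Contracting the edge \<open>{u, v}\<close> keeps the name \<open>u\<close> for the merged vertex; loops and
  parallel edges are discarded. If \<open>v\<close> is the root, the root becomes \<open>u\<close>.
\<close>

definition contract_map :: "'a \<Rightarrow> 'a \<Rightarrow> 'a \<Rightarrow> 'a" where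
  "contract_map u v = (\<lambda>x. if x = v then u else x)"

inductive minor_step :: "'a rooted_graph \<Rightarrow> 'a rooted_graph \<Rightarrow> bool" where
  delete_edge: "e \<in> edges G \<Longrightarrow>
    minor_step G \<lparr>verts = verts G, edges = edges G - {e}, root = root G\<rparr>"
| delete_vertex: "v \<in> verts G \<Longrightarrow> v \<noteq> root G \<Longrightarrow>
    minor_step G \<lparr>verts = verts G - {v}, edges = {e \<in> edges G. v \<notin> e}, root = root G\<rparr>"
| contract_edge: "{u, v} \<in> edges G \<Longrightarrow> u \<noteq> v \<Longrightarrow>
    minor_step G \<lparr>verts = verts G - {v},
                  edges = {contract_map u v ` e | e. e \<in> edges G \<and> e \<noteq> {u, v}},
                  root = contract_map u v (root G)\<rparr>"

definition rooted_iso :: "'a rooted_graph \<Rightarrow> 'a rooted_graph \<Rightarrow> bool" where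
  "rooted_iso G H \<longleftrightarrow>
     (\<exists>f. bij_betw f (verts G) (verts H) \<and> edges H = (\<lambda>e. f ` e) ` edges G \<and> f (root G) = root H)"

definition rooted_minor :: "'a rooted_graph \<Rightarrow> 'a rooted_graph \<Rightarrow> bool" where
  "rooted_minor F G \<longleftrightarrow> (\<exists>F'. minor_step\<^sup>*\<^sup>* G F' \<and> rooted_iso F' F)"

definition proper_rooted_minor :: "'a rooted_graph \<Rightarrow> 'a rooted_graph \<Rightarrow> bool" where
  "proper_rooted_minor F G \<longleftrightarrow> rooted_minor F G \<and> \<not> rooted_iso F G"

definition minimal_minor :: "nat \<Rightarrow> 'a rooted_graph \<Rightarrow> bool" where
  "minimal_minor s G \<longleftrightarrow>
     rooted_graph G \<and> s \<le> xixi G \<and> (\<forall>F. proper_rooted_minor F G \<longrightarrow> xixi F < s)"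

definition extends_root :: "'a rooted_graph \<Rightarrow> 'a rooted_graph \<Rightarrow> bool" where
  "extends_root H G \<longleftrightarrow>
     root G \<notin> verts H \<and>
     verts G = insert (root G) (verts H) \<and>
     edges G = insert {root G, root H} (edges H)"

end

theory Submission
  imports Defs
begin

text \<open>
  By interlacing, the pairs \<open>(k, l)\<close> with \<open>k \<le> l\<close> are those with \<open>l = k\<close> or \<open>l = k + 1\<close>. Three
  facts relate them. (1) If \<open>(G, i)\<close> allows \<open>(m, m + 1)\<close>, some vector of the kernel of \<open>A(i)\<close> is
  nonzero at a neighbour \<open>d\<close> of \<open>i\<close>, and \<open>G - i\<close> rooted at \<open>d\<close>, which is a rooted minor of
  \<open>(G, i)\<close>, allows \<open>(m, m)\<close>. (2) If \<open>(H, j)\<close> allows \<open>(m, m)\<close>, its root extension allows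
  \<open>(m, m + 1)\<close>: the entry at \<open>(j, j)\<close> is irrelevant for the \<open>j\<close>-SNIP and can be chosen to make the
  nullity \<open>m + 1\<close>. (3) If \<open>(G, i)\<close> allows \<open>(m, m)\<close> with \<open>m > 0\<close>, it allows \<open>(l, l + 1)\<close> for some
  \<open>l \<ge> m - 1\<close>: the SNIP is a transversality condition, so the matrix can be perturbed within its
  pattern until the row of \<open>i\<close> is no longer orthogonal to the kernel of \<open>A(i)\<close>.

  So \<open>\<xi>\<xi>(G, i) \<ge> 2k + 1\<close> forces \<open>(G, i)\<close> to contain the root extension of a graph with
  \<open>\<xi>\<xi> \<ge> 2k\<close> as a rooted minor, and such extensions satisfy \<open>\<xi>\<xi> \<ge> 2k + 1\<close> unless the smaller
  graph does so already. Minimality is then transferred by comparing numbers of vertices and edges.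
\<close>

section \<open>Linear algebra of finitely supported functions\<close>

text \<open>The perturbation in (3) solves \<open>B x_j = 0\<close> for \<open>j > 0\<close> and
  \<open>B x_0 = \<epsilon> e_i\<close>, with all vectors \<open>x_j\<close> vanishing at
  \<open>i\<close>: then every \<open>x_j\<close> lies in the kernel of \<open>B(i)\<close>, and row
  \<open>i\<close> does not annihilate \<open>x_0\<close>. The obstacle is that with two or more
  vectors the linearised system is not onto. Symmetry of \<open>B\<close> makes the pairing of the
  residual of \<open>x_j\<close> with \<open>x_l\<close> symmetric in \<open>j\<close> and
  \<open>l\<close>, and this condition on the residuals varies with the point. Surjectivity is
  therefore replaced by compactness: the residual norm is minimised up to a small penalty, and the
  SNIP together with this very symmetry excludes a nonzero limit of normalised residuals. For
  minimality, the point is that rerooting at a neighbour of the root is compatible with minors. If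
  \<open>F\<close> is a rooted minor of \<open>G\<close>, a rerooting of \<open>F\<close> is a
  rooted minor of some rerooting of \<open>G\<close>; when \<open>G\<close> is a root extension of
  \<open>H\<close>, the only rerooting of \<open>G\<close> at a neighbour of its root is
  \<open>H\<close>.\<close>

definition supported_on :: "'a set \<Rightarrow> ('a \<Rightarrow> real) set" where
  "supported_on V = {x. \<forall>v. v \<notin> V \<longrightarrow> x v = 0}"

lemma sum_real_fun_apply: "(\<Sum>i\<in>I. f i :: 'a \<Rightarrow> real) v = (\<Sum>i\<in>I. f i v)"
  by (induction I rule: infinite_finite_induct) auto

lemma supported_on_subset_span:
  assumes "finite V"
  shows "supported_on V \<subseteq> fun_vs.span ((\<lambda>v w. if w = v then 1 else 0) ` V)"
proof
  fix x :: "'a \<Rightarrow> real" assume x: "x \<in> supported_on V"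
  have "x = (\<Sum>v\<in>V. (\<lambda>w. x v * (if w = v then 1 else 0)))"
    using assms x by (auto simp: fun_eq_iff sum_real_fun_apply supported_on_def if_distrib sum.delta cong: if_cong)
  also have "\<dots> \<in> fun_vs.span ((\<lambda>v w. if w = v then 1 else 0) ` V)"
    by (intro fun_vs.span_sum fun_vs.span_scale fun_vs.span_base) auto
  finally show "x \<in> fun_vs.span ((\<lambda>v w. if w = v then 1 else 0) ` V)" .
qed

lemma finite_independent_supported:
  assumes "finite V" "S \<subseteq> supported_on V" "fun_vs.independent S"
  shows "finite S" "card S \<le> card V"
proof -
  let ?D = "(\<lambda>v w. if w = v then 1 else 0 :: real) ` V"
  have "finite S \<and> card S \<le> card ?D"
    using fun_vs.independent_span_bound[of ?D S] assms supported_on_subset_span[of V] by auto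
  moreover have "card ?D \<le> card V" using assms card_image_le by blast
  ultimately show "finite S" "card S \<le> card V" by auto
qed

lemma dim_le_card_supported:
  assumes "finite V" "S \<subseteq> supported_on V"
  shows "fun_vs.dim S \<le> card V"
proof -
  obtain B where "B \<subseteq> S" "fun_vs.independent B" "S \<subseteq> fun_vs.span B" "card B = fun_vs.dim S"
    by (rule fun_vs.basis_exists)
  then show ?thesis using finite_independent_supported[of V B] assms by auto
qed

lemma card_independent_le_dim:
  assumes "finite V" "S \<subseteq> supported_on V" "B \<subseteq> S" "fun_vs.independent B"
  shows "card B \<le> fun_vs.dim S"
proof -
  obtain C where C: "C \<subseteq> S" "fun_vs.independent C" "S \<subseteq> fun_vs.span C" "card C = fun_vs.dim S"
    by (rule fun_vs.basis_exists)
  then have "finite C" using finite_independent_supported[of V C] assms by auto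
  then show ?thesis using fun_vs.independent_span_bound[of C B] assms C by auto
qed

lemma independent_family_le_dim:
  fixes X :: "nat \<Rightarrow> 'a \<Rightarrow> real"
  assumes "finite V" "S \<subseteq> supported_on V" "\<And>j. j < m \<Longrightarrow> X j \<in> S"
    and indep: "\<And>c j. (\<And>v. (\<Sum>l<m. c l * X l v) = 0) \<Longrightarrow> j < m \<Longrightarrow> c j = (0::real)"
  shows "m \<le> fun_vs.dim S"
proof -
  have inj: "inj_on X {..<m}"
  proof (rule inj_onI, rule ccontr)
    fix a b assume ab: "a \<in> {..<m}" "b \<in> {..<m}" "X a = X b" "a \<noteq> b"
    let ?c = "\<lambda>l. (if l = a then 1 else 0) - (if l = b then 1 else 0 :: real)"
    have "(\<Sum>l<m. ?c l * X l v) = 0" for v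
      using ab by (simp add: left_diff_distrib sum_subtractf if_distrib[of "\<lambda>x. x * _"] cong: if_cong)
    from indep[of ?c a, OF this] ab show False by auto
  qed
  have "fun_vs.independent (X ` {..<m})"
  proof (rule fun_vs.independent_if_scalars_zero)
    fix f x assume s: "(\<Sum>x\<in>X ` {..<m}. (\<lambda>v. f x * x v)) = 0" and x: "x \<in> X ` {..<m}"
    then obtain j where j: "j < m" "x = X j" by auto
    have "(\<Sum>l<m. f (X l) * X l v) = 0" for v
    proof -
      have "(\<Sum>l<m. f (X l) * X l v) = (\<Sum>x\<in>X ` {..<m}. (\<lambda>v. f x * x v)) v"
        by (simp add: sum_real_fun_apply sum.reindex[OF inj])
      then show ?thesis using s by simp
    qed
    from indep[of "\<lambda>l. f (X l)" j, OF this] j show "f x = 0" by auto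
  qed simp
  moreover have "X ` {..<m} \<subseteq> S" using assms by auto
  ultimately have "card (X ` {..<m}) \<le> fun_vs.dim S"
    using card_independent_le_dim assms by blast
  then show ?thesis by (simp add: card_image inj)
qed

text \<open>A basis of the zero set of \<open>f\<close> becomes a basis of \<open>S\<close> once
  \<open>s\<close> is added. The comparisons of nullities below use it with \<open>f\<close> either
  the row of the deleted vertex or the coordinate at that vertex.\<close>

lemma dim_functional:
  assumes V: "finite V" "S \<subseteq> supported_on V" and S: "fun_vs.subspace S"
    and f_add: "\<And>x y. f (\<lambda>v. x v + y v) = f x + f y" and f_scale: "\<And>c x. f (\<lambda>v. c * x v) = c * f x"
    and s: "s \<in> S" "f s \<noteq> (0::real)"
  shows "fun_vs.dim S = Suc (fun_vs.dim {x\<in>S. f x = 0})"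
proof -
  let ?S0 = "{x\<in>S. f x = 0}"
  have f0: "f 0 = 0" using f_scale[of 0 s] by (simp add: zero_fun_def)
  have sub0: "fun_vs.subspace ?S0"
    unfolding fun_vs.subspace_def
    using fun_vs.subspace_0[OF S] fun_vs.subspace_add[OF S] fun_vs.subspace_scale[OF S]
    by (auto simp: f0 f_scale f_add plus_fun_def)
  obtain B where B: "B \<subseteq> ?S0" "fun_vs.independent B" "?S0 \<subseteq> fun_vs.span B" "card B = fun_vs.dim ?S0"
    by (rule fun_vs.basis_exists)
  have "fun_vs.span B \<subseteq> ?S0" by (rule fun_vs.span_minimal[OF B(1) sub0])
  then have sB: "s \<notin> fun_vs.span B" using s by auto
  have finB: "finite B" using finite_independent_supported[of V B] B V by auto
  have ind: "fun_vs.independent (insert s B)" using fun_vs.independent_insertI[OF sB B(2)] .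
  have "S \<subseteq> fun_vs.span (insert s B)"
  proof
    fix x assume x: "x \<in> S"
    let ?c = "f x / f s"
    let ?y = "\<lambda>v. x v + (- ?c) * s v"
    have "f ?y = 0" using f_add[of x "\<lambda>v. (- ?c) * s v"] f_scale[of "- ?c" s] s by simp
    moreover have "?y \<in> S"
      using fun_vs.subspace_add[OF S x fun_vs.subspace_scale[OF S s(1), of "- ?c"]]
      by (simp add: plus_fun_def)
    ultimately have "?y \<in> fun_vs.span (insert s B)"
      using B(3) fun_vs.span_mono[of B "insert s B"] by blast
    moreover have "(\<lambda>v. ?c * s v) \<in> fun_vs.span (insert s B)"
      by (intro fun_vs.span_scale fun_vs.span_base) auto
    ultimately have "?y + (\<lambda>v. ?c * s v) \<in> fun_vs.span (insert s B)" by (rule fun_vs.span_add)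
    moreover have "?y + (\<lambda>v. ?c * s v) = x" by (auto simp: fun_eq_iff)
    ultimately show "x \<in> fun_vs.span (insert s B)" by simp
  qed
  moreover have "insert s B \<subseteq> S" using B s by auto
  ultimately have "fun_vs.dim S = card (insert s B)"
    using fun_vs.basis_card_eq_dim ind by metis
  moreover have "s \<notin> B" using sB fun_vs.span_base by blast
  ultimately show ?thesis using finB B(4) by simp
qed

lemma real_functional_extend:
  assumes "fun_vs.independent B"
  shows "\<exists>f :: ('a \<Rightarrow> real) \<Rightarrow> real.
    (\<forall>x y. f (x + y) = f x + f y) \<and> (\<forall>c x. f (\<lambda>v. c * x v) = c * f x) \<and> (\<forall>x\<in>B. f x = g x)"
proof -
  interpret p: vector_space_pair "\<lambda>(c::real) (x::'a \<Rightarrow> real) v. c * x v" "(*) :: real \<Rightarrow> real \<Rightarrow> real"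
    by unfold_locales (auto simp: algebra_simps)
  obtain f where f: "Vector_Spaces.linear (\<lambda>c x v. c * x v) (*) f" "\<forall>x\<in>B. f x = g x"
    using p.linear_independent_extend[OF assms] by blast
  interpret l: Vector_Spaces.linear "\<lambda>c x v. c * x v" "(*)" f by (rule f)
  show ?thesis using l.add l.scale f by auto
qed

text \<open>A functional with value 1 at \<open>c\<close> and 0 on a basis of \<open>S\<close> is
  represented on functions supported on \<open>V\<close> by its values at the unit vectors.\<close>

lemma separating_vector:
  assumes V: "finite V" "S \<subseteq> supported_on V" and c: "c \<in> supported_on V" "c \<notin> fun_vs.span S"
  shows "\<exists>y\<in>supported_on V. (\<forall>s\<in>S. (\<Sum>v\<in>V. y v * s v) = 0) \<and> (\<Sum>v\<in>V. y v * c v) = 1"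
proof -
  obtain B where B: "B \<subseteq> S" "fun_vs.independent B" "S \<subseteq> fun_vs.span B" "card B = fun_vs.dim S"
    by (rule fun_vs.basis_exists)
  have cB: "c \<notin> fun_vs.span B" using c B fun_vs.span_mono by blast
  then have "fun_vs.independent (insert c B)" using fun_vs.independent_insertI B by blast
  from real_functional_extend[OF this, of "\<lambda>x. if x = c then 1 else 0"]
  obtain f :: "('a \<Rightarrow> real) \<Rightarrow> real"
    where f: "\<forall>x y. f (x + y) = f x + f y" "\<forall>a x. f (\<lambda>v. a * x v) = a * f x"
      "\<forall>x\<in>insert c B. f x = (if x = c then 1 else 0)"
    by (elim exE conjE)
  have f0: "f 0 = 0" using f(2)[rule_format, of 0 c] by (simp add: zero_fun_def)
  have fsum: "f (\<Sum>i\<in>I. h i) = (\<Sum>i\<in>I. f (h i))" for I :: "'a set" and h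
  proof (induction I rule: infinite_finite_induct)
    case (insert x F)
    then show ?case using f(1)[rule_format, of "h x" "\<Sum>i\<in>F. h i"] by (simp add: plus_fun_def)
  qed (use f0 in \<open>simp_all add: zero_fun_def\<close>)
  define \<delta> where "\<delta> = (\<lambda>(v::'a) w. if w = v then 1 else 0 :: real)"
  define y where "y v = (if v \<in> V then f (\<delta> v) else 0)" for v
  have fy: "(\<Sum>v\<in>V. y v * x v) = f x" if "x \<in> supported_on V" for x
  proof -
    have "x = (\<Sum>v\<in>V. (\<lambda>w. x v * \<delta> v w))"
      using V that by (auto simp: fun_eq_iff sum_real_fun_apply supported_on_def \<delta>_def if_distrib sum.delta cong: if_cong)
    then have "f x = (\<Sum>v\<in>V. x v * f (\<delta> v))" using fsum[of "\<lambda>v w. x v * \<delta> v w" V] f(2) by simp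
    also have "\<dots> = (\<Sum>v\<in>V. y v * x v)" by (rule sum.cong) (auto simp: y_def)
    finally show ?thesis by simp
  qed
  have "f s = 0" if "s \<in> S" for s
  proof -
    have "s \<in> fun_vs.span B" using that B by auto
    moreover have "fun_vs.subspace {x. f x = 0}"
      unfolding fun_vs.subspace_def by (auto simp: f(1,2) f0)
    moreover have "B \<subseteq> {x. f x = 0}"
    proof
      fix x assume "x \<in> B"
      moreover from this have "x \<noteq> c" using cB fun_vs.span_base by blast
      ultimately show "x \<in> {x. f x = 0}" using f(3) by auto
    qed
    ultimately show "f s = 0" using fun_vs.span_minimal by blast
  qed
  then have "\<forall>s\<in>S. (\<Sum>v\<in>V. y v * s v) = 0" using fy V by auto
  moreover have "(\<Sum>v\<in>V. y v * c v) = 1" using fy c f(3) by auto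
  moreover have "y \<in> supported_on V" by (simp add: y_def supported_on_def)
  ultimately show ?thesis by blast
qed

text \<open>\<open>X\<close> enumerates a basis of \<open>S\<close>, and \<open>Y j\<close>
  separates \<open>X j\<close> from the span of the other basis vectors. Pairing with
  \<open>Y\<close> reads off coefficients with respect to \<open>X\<close>, and it detects that a
  family close to \<open>X\<close> is still independent.\<close>

lemma dual_family:
  assumes V: "finite V" "S \<subseteq> supported_on V"
  obtains X Y :: "nat \<Rightarrow> 'a \<Rightarrow> real"
  where "\<And>j. j < fun_vs.dim S \<Longrightarrow> X j \<in> S"
    "\<And>j l. j < fun_vs.dim S \<Longrightarrow> l < fun_vs.dim S \<Longrightarrow> (\<Sum>v\<in>V. Y j v * X l v) = (if j = l then 1 else 0)"
proof -
  let ?m = "fun_vs.dim S"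
  obtain B where B: "B \<subseteq> S" "fun_vs.independent B" "S \<subseteq> fun_vs.span B" "card B = ?m"
    by (rule fun_vs.basis_exists)
  have "finite B" using finite_independent_supported[of V B] B V by auto
  then obtain X where X: "bij_betw X {..<?m} B"
    using ex_bij_betw_nat_finite[of B] B by (metis atLeast0LessThan)
  have "\<exists>y. \<forall>l<?m. (\<Sum>v\<in>V. y v * X l v) = (if j = l then 1 else 0)" if j: "j < ?m" for j
  proof -
    have XB: "X l \<in> B" if "l < ?m" for l using X that by (auto simp: bij_betw_def)
    have "X j \<notin> fun_vs.span (B - {X j})"
      using B(2) XB[OF j] fun_vs.dependent_def by auto
    then obtain y where y: "\<forall>s\<in>B - {X j}. (\<Sum>v\<in>V. y v * s v) = 0" "(\<Sum>v\<in>V. y v * X j v) = 1"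
      using separating_vector[of V "B - {X j}" "X j"] V B XB[OF j] by blast
    have "X l \<noteq> X j" if "l < ?m" "l \<noteq> j" for l
      using X that j by (auto simp: bij_betw_def inj_on_def)
    then show ?thesis using y XB by (intro exI[of _ y]) auto
  qed
  then have "\<forall>j. \<exists>y. j < ?m \<longrightarrow> (\<forall>l<?m. (\<Sum>v\<in>V. y v * X l v) = (if j = l then 1 else 0))" by blast
  from choice[OF this] obtain Y
    where "\<forall>j. j < ?m \<longrightarrow> (\<forall>l<?m. (\<Sum>v\<in>V. Y j v * X l v) = (if j = l then 1 else 0))" ..
  moreover have "\<And>j. j < ?m \<Longrightarrow> X j \<in> S" using X B by (auto simp: bij_betw_def)
  ultimately show ?thesis using that[of X Y] by simp
qed

section \<open>Kernels and ranges of symmetric matrices\<close>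

lemma kernel_supported: "kernel_on V A \<subseteq> supported_on V"
  by (auto simp: kernel_on_def supported_on_def)

lemma subspace_kernel: "fun_vs.subspace (kernel_on V A)"
  unfolding fun_vs.subspace_def kernel_on_def
proof (intro conjI ballI allI)
  fix c x assume x: "x \<in> {x. (\<forall>v. v \<notin> V \<longrightarrow> x v = 0) \<and> (\<forall>u\<in>V. (\<Sum>v\<in>V. A u v * x v) = 0)}"
  have "(\<Sum>v\<in>V. A u v * (c * x v)) = c * (\<Sum>v\<in>V. A u v * x v)" for u
    by (simp add: sum_distrib_left mult_ac)
  then show "(\<lambda>v. c * x v) \<in> {x. (\<forall>v. v \<notin> V \<longrightarrow> x v = 0) \<and> (\<forall>u\<in>V. (\<Sum>v\<in>V. A u v * x v) = 0)}"
    using x by simp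
qed (auto simp: distrib_left sum.distrib)

lemma nullity_le_card: "finite V \<Longrightarrow> nullity V A \<le> card V"
  unfolding nullity_def by (rule dim_le_card_supported[OF _ kernel_supported])

lemma bilinear_symmetric:
  assumes "symmetric_on V A"
  shows "(\<Sum>u\<in>V. x u * (\<Sum>v\<in>V. A u v * y v)) = (\<Sum>u\<in>V. y u * (\<Sum>v\<in>V. A u v * x v))"
proof -
  have "(\<Sum>u\<in>V. x u * (\<Sum>v\<in>V. A u v * y v)) = (\<Sum>u\<in>V. \<Sum>v\<in>V. A u v * x u * y v)"
    by (simp add: sum_distrib_left mult_ac)
  also have "\<dots> = (\<Sum>v\<in>V. \<Sum>u\<in>V. A u v * x u * y v)" by (rule sum.swap)
  also have "\<dots> = (\<Sum>v\<in>V. \<Sum>u\<in>V. A v u * x u * y v)"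
    using assms by (intro sum.cong refl) (auto simp: symmetric_on_def)
  also have "\<dots> = (\<Sum>u\<in>V. y u * (\<Sum>v\<in>V. A u v * x v))"
    by (simp add: sum_distrib_left mult_ac)
  finally show ?thesis .
qed

lemma symmetric_on_subset: "symmetric_on V A \<Longrightarrow> W \<subseteq> V \<Longrightarrow> symmetric_on W A"
  by (auto simp: symmetric_on_def)

text \<open>Fredholm alternative: a vector separating \<open>c\<close> from the range is orthogonal
  to every column of \<open>A\<close>, so by symmetry it lies in the kernel, to which
  \<open>c\<close> is orthogonal.\<close>

lemma orthogonal_to_kernel_in_range:
  assumes V: "finite V" and A: "symmetric_on V A"
    and c: "\<And>z. z \<in> kernel_on V A \<Longrightarrow> (\<Sum>v\<in>V. c v * z v) = 0"
  obtains w where "w \<in> supported_on V" "\<And>u. u \<in> V \<Longrightarrow> (\<Sum>v\<in>V. A u v * w v) = c u"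
proof -
  define T where "T w = (\<lambda>u. if u \<in> V then \<Sum>v\<in>V. A u v * w v else 0)" for w
  define c' where "c' = (\<lambda>u. if u \<in> V then c u else 0)"
  let ?S = "T ` supported_on V"
  have sub: "fun_vs.subspace ?S"
    unfolding fun_vs.subspace_def
  proof (intro conjI ballI allI)
    show "0 \<in> ?S" by (rule image_eqI[of _ _ "\<lambda>_. 0"]) (auto simp: T_def supported_on_def)
  next
    fix x y assume "x \<in> ?S" "y \<in> ?S"
    then obtain a b where ab: "x = T a" "y = T b" "a \<in> supported_on V" "b \<in> supported_on V" by auto
    then show "x + y \<in> ?S"
      by (intro image_eqI[of _ _ "a + b"]) (auto simp: T_def supported_on_def fun_eq_iff distrib_left sum.distrib)
  next
    fix k x assume "x \<in> ?S"
    then obtain a where "x = T a" "a \<in> supported_on V" by auto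
    then show "(\<lambda>v. k * x v) \<in> ?S"
      by (intro image_eqI[of _ _ "\<lambda>v. k * a v"]) (auto simp: T_def supported_on_def fun_eq_iff sum_distrib_left mult_ac)
  qed
  have "c' \<in> ?S"
  proof (rule ccontr)
    assume "c' \<notin> ?S"
    then have "c' \<notin> fun_vs.span ?S" using sub by (metis fun_vs.span_eq_iff)
    moreover have "?S \<subseteq> supported_on V" by (auto simp: T_def supported_on_def)
    moreover have "c' \<in> supported_on V" by (auto simp: c'_def supported_on_def)
    ultimately obtain y where y: "y \<in> supported_on V" "\<forall>s\<in>?S. (\<Sum>v\<in>V. y v * s v) = 0"
      "(\<Sum>v\<in>V. y v * c' v) = 1" using separating_vector[OF V] by blast
    have "(\<Sum>v\<in>V. A u v * y v) = 0" if u: "u \<in> V" for u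
    proof -
      let ?d = "\<lambda>w. if w = u then 1 else 0 :: real"
      have "T ?d \<in> ?S" using u by (auto simp: supported_on_def)
      from y(2)[rule_format, OF this] have "0 = (\<Sum>v\<in>V. y v * (\<Sum>w\<in>V. A v w * ?d w))"
        by (simp add: T_def)
      also have "\<dots> = (\<Sum>v\<in>V. ?d v * (\<Sum>w\<in>V. A v w * y w))" by (rule bilinear_symmetric[OF A])
      also have "\<dots> = (\<Sum>w\<in>V. A u w * y w)"
        using V u by (simp add: if_distrib[of "\<lambda>x. x * _"] cong: if_cong)
      finally show ?thesis by simp
    qed
    then have "y \<in> kernel_on V A" using y by (auto simp: kernel_on_def supported_on_def)
    from c[OF this] have "(\<Sum>v\<in>V. y v * c' v) = 0" by (simp add: c'_def mult.commute)
    then show False using y by simp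
  qed
  then obtain w where "w \<in> supported_on V" "c' = T w" by auto
  then show ?thesis using that[of w] by (auto simp: T_def c'_def fun_eq_iff split: if_splits)
qed

section \<open>Nullity pairs\<close>

lemma nullity_cong:
  assumes "\<And>u v. u \<in> V \<Longrightarrow> v \<in> V \<Longrightarrow> A u v = B u v"
  shows "nullity V A = nullity V B"
proof -
  have "(\<Sum>v\<in>V. A u v * x v) = (\<Sum>v\<in>V. B u v * x v)" if "u \<in> V" for u x
    using that assms by (intro sum.cong) auto
  then have "kernel_on V A = kernel_on V B" by (auto simp: kernel_on_def)
  then show ?thesis by (simp add: nullity_def)
qed

text \<open>The row of \<open>i\<close> is not orthogonal to the kernel of \<open>A(i)\<close>. Among nullity pairs
  \<open>(k, l)\<close> with \<open>k \<le> l\<close> this singles out those with \<open>l = k + 1\<close>.\<close>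
definition parter :: "'a set \<Rightarrow> 'a \<Rightarrow> 'a matrix \<Rightarrow> bool" where
  "parter V i A \<longleftrightarrow> (\<exists>z\<in>kernel_on (V - {i}) A. (\<Sum>v\<in>V - {i}. A i v * z v) \<noteq> 0)"

text \<open>Neither \<open>A(i)\<close> nor the pairing of row \<open>i\<close> with vectors on
  \<open>V - {i}\<close> involves the entry at \<open>(i, i)\<close>, which leaves that entry free
  for adjusting the nullity of \<open>A\<close>.\<close>

lemma parter_cong:
  assumes "i \<in> V" "\<And>u v. u \<in> V \<Longrightarrow> v \<in> V \<Longrightarrow> (u, v) \<noteq> (i, i) \<Longrightarrow> A u v = B u v"
  shows "parter V i A = parter V i B"
proof -
  have "(\<Sum>v\<in>V - {i}. A u v * x v) = (\<Sum>v\<in>V - {i}. B u v * x v)" if "u \<in> V" for u x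
    using that assms by (intro sum.cong) auto
  moreover from this have "kernel_on (V - {i}) A = kernel_on (V - {i}) B" by (auto simp: kernel_on_def)
  ultimately show ?thesis using assms(1) by (simp add: parter_def)
qed

text \<open>A vector that vanishes at \<open>i\<close> does not see column \<open>i\<close>. This
  common subspace of the two kernels links the nullities of \<open>A\<close> and
  \<open>A(i)\<close>.\<close>

lemma kernel_vanishing_at:
  assumes "finite V" "i \<in> V"
  shows "{x \<in> kernel_on V A. x i = 0} = {z \<in> kernel_on (V - {i}) A. (\<Sum>v\<in>V - {i}. A i v * z v) = 0}"
proof -
  have *: "(\<Sum>v\<in>V. A u v * x v) = (\<Sum>v\<in>V - {i}. A u v * x v)" if "x i = 0" for u x
    using sum.remove[OF assms, of "\<lambda>v. A u v * x v"] that by simp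
  show ?thesis using assms(2) by (auto simp: kernel_on_def *)
qed

text \<open>If \<open>z\<close> witnesses \<open>parter\<close>, then \<open>A z\<close> is a
  nonzero multiple of the unit vector at \<open>i\<close>. Pairing \<open>z\<close> with
  \<open>A x = 0\<close> and using symmetry leaves that multiple of \<open>x i\<close>.\<close>

lemma parter_kernel_zero:
  assumes V: "finite V" "i \<in> V" and A: "symmetric_on V A" and P: "parter V i A" and x: "x \<in> kernel_on V A"
  shows "x i = 0"
proof -
  obtain z where z: "z \<in> kernel_on (V - {i}) A" "(\<Sum>v\<in>V - {i}. A i v * z v) \<noteq> 0"
    using P by (auto simp: parter_def)
  have zi: "z i = 0" using z by (auto simp: kernel_on_def)
  have *: "(\<Sum>v\<in>V. A u v * z v) = (\<Sum>v\<in>V - {i}. A u v * z v)" for u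
    using sum.remove[OF V, of "\<lambda>v. A u v * z v"] zi by simp
  have "0 = (\<Sum>u\<in>V. z u * (\<Sum>v\<in>V. A u v * x v))" using x by (simp add: kernel_on_def)
  also have "\<dots> = (\<Sum>u\<in>V. x u * (\<Sum>v\<in>V. A u v * z v))" by (rule bilinear_symmetric[OF A])
  also have "\<dots> = x i * (\<Sum>v\<in>V. A i v * z v)"
  proof -
    have "(\<Sum>u\<in>V - {i}. x u * (\<Sum>v\<in>V. A u v * z v)) = 0"
      unfolding * using z(1) by (intro sum.neutral) (auto simp: kernel_on_def)
    then show ?thesis using sum.remove[OF V, of "\<lambda>u. x u * (\<Sum>v\<in>V. A u v * z v)"] by simp
  qed
  finally show ?thesis using z(2) * by auto
qed

lemma nullity_parter:
  assumes V: "finite V" "i \<in> V" and A: "symmetric_on V A" and P: "parter V i A"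
  shows "nullity (V - {i}) A = Suc (nullity V A)"
proof -
  have "kernel_on V A = {x \<in> kernel_on V A. x i = 0}" using parter_kernel_zero[OF V A P] by auto
  then have K: "kernel_on V A = {z \<in> kernel_on (V - {i}) A. (\<Sum>v\<in>V - {i}. A i v * z v) = 0}"
    by (simp only: kernel_vanishing_at[OF V])
  obtain z where z: "z \<in> kernel_on (V - {i}) A" "(\<Sum>v\<in>V - {i}. A i v * z v) \<noteq> 0"
    using P by (auto simp: parter_def)
  show ?thesis unfolding nullity_def K
    by (rule dim_functional[where f = "\<lambda>z. \<Sum>v\<in>V - {i}. A i v * z v", OF _ kernel_supported subspace_kernel _ _ z])
       (use V in \<open>auto simp: distrib_left sum.distrib sum_distrib_left mult_ac\<close>)
qed

lemma nullity_not_parter: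
  assumes V: "finite V" "i \<in> V" and P: "\<not> parter V i A"
  shows "nullity V A = (if \<exists>x\<in>kernel_on V A. x i \<noteq> 0 then Suc (nullity (V - {i}) A) else nullity (V - {i}) A)"
proof -
  have K: "kernel_on (V - {i}) A = {x \<in> kernel_on V A. x i = 0}"
    using P by (auto simp: kernel_vanishing_at[OF V] parter_def)
  show ?thesis
  proof (cases "\<exists>x\<in>kernel_on V A. x i \<noteq> 0")
    case True
    then obtain x where x: "x \<in> kernel_on V A" "x i \<noteq> 0" by auto
    have "nullity V A = Suc (nullity (V - {i}) A)" unfolding nullity_def K
      by (rule dim_functional[where f = "\<lambda>x. x i", OF V(1) kernel_supported subspace_kernel _ _ x]) auto
    then show ?thesis using True by simp
  next
    case False
    then have "kernel_on (V - {i}) A = kernel_on V A" unfolding K by auto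
    then show ?thesis using False by (auto simp: nullity_def)
  qed
qed

text \<open>Without a witness for \<open>parter\<close>, passing from \<open>A(i)\<close> to
  \<open>A\<close> keeps the nullity or raises it by one; the assumed inequality excludes the
  rise.\<close>

lemma nullity_pair_parter:
  assumes "finite V" "i \<in> V" "symmetric_on V A" "nullity V A \<le> nullity (V - {i}) A"
  shows "nullity (V - {i}) A = (if parter V i A then Suc (nullity V A) else nullity V A)"
proof (cases "parter V i A")
  case False
  from nullity_not_parter[OF assms(1,2) this] assms(4) False show ?thesis
    by (simp split: if_splits)
qed (use nullity_parter[OF assms(1-3)] in simp)

section \<open>The SNIP and its transfer along root extensions\<close>

lemma SNIP_D:
  assumes "SNIP V i A" "\<And>u v. u \<in> V \<Longrightarrow> v \<in> V \<Longrightarrow> X u v = X v u"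
    "\<And>u v. u \<in> V \<Longrightarrow> v \<in> V \<Longrightarrow> u = v \<or> A u v \<noteq> 0 \<Longrightarrow> X u v = 0"
    "\<And>u v. u \<in> V \<Longrightarrow> u \<noteq> i \<Longrightarrow> v \<in> V \<Longrightarrow> (\<Sum>w\<in>V. A u w * X w v) = 0" "u \<in> V" "v \<in> V"
  shows "X u v = 0"
proof -
  have "symmetric_on V X" using assms(2) by (simp add: symmetric_on_def)
  moreover have "zero_on V V (entrywise_prod A X)" "zero_on V V (entrywise_prod id_matrix X)"
    using assms(3) by (auto simp: zero_on_def entrywise_prod_def id_matrix_def)
  moreover have "zero_on (V - {i}) V (matrix_prod_on V A X)"
    using assms(4) by (simp add: zero_on_def matrix_prod_on_def)
  ultimately have "zero_on V V X" using assms(1) unfolding SNIP_def by blast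
  then show ?thesis using assms(5,6) by (simp add: zero_on_def)
qed

lemma SNIP_I:
  assumes "symmetric_on V A"
    "\<And>X u v. (\<And>u v. u \<in> V \<Longrightarrow> v \<in> V \<Longrightarrow> X u v = X v u) \<Longrightarrow>
      (\<And>u v. u \<in> V \<Longrightarrow> v \<in> V \<Longrightarrow> u = v \<or> A u v \<noteq> 0 \<Longrightarrow> X u v = 0) \<Longrightarrow>
      (\<And>u v. u \<in> V \<Longrightarrow> u \<noteq> i \<Longrightarrow> v \<in> V \<Longrightarrow> (\<Sum>w\<in>V. A u w * X w v) = 0) \<Longrightarrow> u \<in> V \<Longrightarrow> v \<in> V \<Longrightarrow> X u v = 0"
  shows "SNIP V i A"
  unfolding SNIP_def zero_on_def
proof (intro conjI allI impI ballI)
  fix X u v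
  assume X: "symmetric_on V X \<and> (\<forall>u\<in>V. \<forall>v\<in>V. entrywise_prod A X u v = 0) \<and>
    (\<forall>u\<in>V. \<forall>v\<in>V. entrywise_prod id_matrix X u v = 0) \<and> (\<forall>u\<in>V - {i}. \<forall>v\<in>V. matrix_prod_on V A X u v = 0)"
    and uv: "u \<in> V" "v \<in> V"
  show "X u v = 0"
  proof (rule assms(2)[OF _ _ _ uv])
    fix u v assume uv: "u \<in> V" "v \<in> V"
    show "X u v = X v u" using X uv by (simp add: symmetric_on_def)
    have "A u v * X u v = 0" "id_matrix u v * X u v = 0" using X uv by (simp_all add: entrywise_prod_def)
    then show "X u v = 0" if "u = v \<or> A u v \<noteq> 0" using that by (auto simp: id_matrix_def)
    show "(\<Sum>w\<in>V. A u w * X w v) = 0" if "u \<noteq> i"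
      using X uv that by (simp add: matrix_prod_on_def)
  qed
qed (rule assms(1))

text \<open>For a neighbour \<open>d\<close> of the root this is a rooted minor: delete the other
  edges at the root, then contract the edge to \<open>d\<close>. It undoes
  \<open>root_extension\<close> by a new vertex when \<open>d\<close> is the former root.\<close>

definition reroot :: "'a rooted_graph \<Rightarrow> 'a \<Rightarrow> 'a rooted_graph" where
  "reroot G d = \<lparr>verts = verts G - {root G}, edges = {e \<in> edges G. root G \<notin> e}, root = d\<rparr>"

definition root_extension :: "'a \<Rightarrow> 'a rooted_graph \<Rightarrow> 'a rooted_graph" where
  "root_extension i H = \<lparr>verts = insert i (verts H), edges = insert {i, root H} (edges H), root = i\<rparr>"

text \<open>The witness \<open>z\<close> of \<open>parter\<close> does all the work. As
  \<open>z d\<close> is nonzero, deleting \<open>d\<close> from \<open>A(i)\<close> lowers the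
  nullity to \<open>m\<close>. After the entry at \<open>(d, d)\<close> is changed, pairing with
  \<open>z\<close> forces kernel vectors to vanish at \<open>d\<close>, so the nullity is
  \<open>m\<close> before the deletion too. For the SNIP, pairing with \<open>z\<close> recovers the
  row of \<open>d\<close>, about which the \<open>d\<close>-SNIP assumes nothing; extension by zero
  at \<open>i\<close> then leads to the \<open>i\<close>-SNIP of \<open>A\<close>.\<close>

lemma allows_reroot:
  assumes G: "rooted_graph G" and a: "allows_with_SNIP G m (Suc m)"
  shows "\<exists>d. {root G, d} \<in> edges G \<and> d \<noteq> root G \<and> allows_with_SNIP (reroot G d) m m"
proof -
  define V i where "V = verts G" and "i = root G"
  have V: "finite V" "i \<in> V" using G by (auto simp: rooted_graph_def V_def i_def)
  obtain A where A: "A \<in> sym_matrices G" "SNIP V i A" "nullity V A = m" "nullity (V - {i}) A = Suc m"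
    using a by (auto simp: allows_with_SNIP_def V_def i_def)
  have sym: "symmetric_on V A" using A by (simp add: SNIP_def)
  define W where "W = V - {i}"
  have W: "finite W" "W \<subseteq> V" "i \<notin> W" "V = insert i W" using V by (auto simp: W_def)
  have symW: "symmetric_on W A" using sym W symmetric_on_subset by blast
  have "parter V i A" using nullity_pair_parter[OF V sym] A by (auto split: if_splits)
  then obtain z where z: "z \<in> kernel_on W A" "(\<Sum>v\<in>W. A i v * z v) \<noteq> 0"
    by (auto simp: parter_def W_def)
  then obtain d where "d \<in> W" "A i d * z d \<noteq> 0" by (meson sum.not_neutral_contains_not_neutral)
  then have d: "d \<in> W" "A i d \<noteq> 0" "z d \<noteq> 0" by auto
  have di: "d \<noteq> i" using d W by auto
  have edge: "{i, d} \<in> edges G"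
    using A(1) d V W di by (auto simp: sym_matrices_def V_def)
  \<comment> \<open>Adding 1 to the diagonal entry changes neither the pattern nor any row other
    than that of \<open>d\<close>; any nonzero increment would serve.\<close>
  define A' where "A' = (\<lambda>u v. if u = d \<and> v = d then A d d + 1 else A u v)"
  have symW': "symmetric_on W A'" using symW by (auto simp: symmetric_on_def A'_def)
  have nP: "\<not> parter W d A" using parter_kernel_zero[OF W(1) d(1) symW _ z(1)] d by auto
  then have "nullity W A = Suc (nullity (W - {d}) A)"
    using nullity_not_parter[OF W(1) d(1) nP] z d by auto
  then have n1: "nullity (W - {d}) A' = m"
    using A(4) nullity_cong[of "W - {d}" A A'] by (auto simp: A'_def W_def)
  have nP': "\<not> parter W d A'" using nP parter_cong[OF d(1), of A A'] by (auto simp: A'_def)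
  have x0: "x d = 0" if x: "x \<in> kernel_on W A'" for x
  proof -
    have row: "(\<Sum>v\<in>W. A' u v * x v) = (\<Sum>v\<in>W. A u v * x v) + (if u = d then x d else 0)" for u
    proof -
      have "(\<Sum>v\<in>W. A' u v * x v) = (\<Sum>v\<in>W. A u v * x v + (if v = d then if u = d then x d else 0 else 0))"
        by (intro sum.cong) (auto simp: A'_def algebra_simps)
      then show ?thesis using W d by (simp add: sum.distrib)
    qed
    have "0 = (\<Sum>u\<in>W. z u * (\<Sum>v\<in>W. A' u v * x v))" using x by (simp add: kernel_on_def)
    also have "\<dots> = (\<Sum>u\<in>W. z u * (\<Sum>v\<in>W. A u v * x v)) + (\<Sum>u\<in>W. if u = d then z d * x d else 0)"
      unfolding row sum.distrib[symmetric] by (intro sum.cong) (auto simp: algebra_simps)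
    also have "(\<Sum>u\<in>W. z u * (\<Sum>v\<in>W. A u v * x v)) = (\<Sum>u\<in>W. x u * (\<Sum>v\<in>W. A u v * z v))"
      by (rule bilinear_symmetric[OF symW])
    also have "\<dots> = 0" using z by (simp add: kernel_on_def)
    finally show ?thesis using W d by simp
  qed
  then have n0: "nullity W A' = m" using nullity_not_parter[OF W(1) d(1) nP'] n1 by auto
  have snip: "SNIP W d A'"
  proof (rule SNIP_I[OF symW'])
    fix X u v
    assume X: "\<And>u v. u \<in> W \<Longrightarrow> v \<in> W \<Longrightarrow> X u v = X v u"
      "\<And>u v. u \<in> W \<Longrightarrow> v \<in> W \<Longrightarrow> u = v \<or> A' u v \<noteq> 0 \<Longrightarrow> X u v = 0"
      "\<And>u v. u \<in> W \<Longrightarrow> u \<noteq> d \<Longrightarrow> v \<in> W \<Longrightarrow> (\<Sum>w\<in>W. A' u w * X w v) = 0"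
      and uv: "u \<in> W" "v \<in> W"
    have row: "(\<Sum>w\<in>W. A u w * X w v) = 0" if u: "u \<in> W" "u \<noteq> d" "v \<in> W" for u v
      using X(3)[OF u] u by (simp add: A'_def)
    have rowd: "(\<Sum>w\<in>W. A d w * X w v) = 0" if v: "v \<in> W" for v
    proof -
      have "0 = (\<Sum>u\<in>W. X u v * (\<Sum>w\<in>W. A u w * z w))" using z by (simp add: kernel_on_def)
      also have "\<dots> = (\<Sum>u\<in>W. z u * (\<Sum>w\<in>W. A u w * X w v))" by (rule bilinear_symmetric[OF symW])
      also have "\<dots> = z d * (\<Sum>w\<in>W. A d w * X w v)"
        using sum.remove[OF W(1) d(1), of "\<lambda>u. z u * (\<Sum>w\<in>W. A u w * X w v)"] row v by simp
      finally show ?thesis using d by simp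
    qed
    define Y where "Y = (\<lambda>u v. if u \<in> W \<and> v \<in> W then X u v else 0)"
    have "Y u v = 0"
    proof (rule SNIP_D[OF A(2)])
      fix u v assume uv: "u \<in> V" "v \<in> V"
      show "Y u v = Y v u" using X(1) by (auto simp: Y_def)
      show "Y u v = 0" if "u = v \<or> A u v \<noteq> 0" using X(2)[of u v] that by (auto simp: Y_def A'_def split: if_splits)
      show "(\<Sum>w\<in>V. A u w * Y w v) = 0" if "u \<noteq> i"
      proof -
        have "(\<Sum>w\<in>V. A u w * Y w v) = (\<Sum>w\<in>W. A u w * Y w v)"
          using W by (simp add: Y_def)
        also have "\<dots> = 0"
          using row[of u v] rowd[of v] uv that W by (cases "v \<in> W"; cases "u = d") (auto simp: Y_def)
        finally show ?thesis .
      qed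
    qed (use uv W in auto)
    then show "X u v = 0" using uv by (simp add: Y_def)
  qed
  have "A' \<in> sym_matrices (reroot G d)"
    using A(1) symW' by (auto simp: sym_matrices_def reroot_def A'_def W_def V_def i_def)
  then have "allows_with_SNIP (reroot G d) m m"
    unfolding allows_with_SNIP_def using snip n0 n1
    by (intro bexI[of _ A']) (auto simp: reroot_def W_def V_def i_def)
  then show ?thesis using edge di by (auto simp: i_def)
qed

text \<open>A vanishing Schur complement at \<open>j\<close> gives a kernel vector that is nonzero
  at \<open>j\<close>, and the new pendant vertex turns this vector into a witness for
  \<open>parter\<close>. In the SNIP equations the rows other than \<open>i\<close> and
  \<open>j\<close> are those of \<open>A\<close> and kill the block on \<open>V\<close>; row
  \<open>j\<close> then kills the row of the new vertex.\<close>

lemma allows_root_extension: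
  assumes H: "rooted_graph H" and i: "i \<notin> verts H" and a: "allows_with_SNIP H m m"
  shows "allows_with_SNIP (root_extension i H) m (Suc m)"
proof -
  define V j where "V = verts H" and "j = root H"
  have V: "finite V" "j \<in> V" "i \<notin> V" "i \<noteq> j" using H i by (auto simp: rooted_graph_def V_def j_def)
  obtain A where A: "A \<in> sym_matrices H" "SNIP V j A" "nullity V A = m" "nullity (V - {j}) A = m"
    using a by (auto simp: allows_with_SNIP_def V_def j_def)
  have sym: "symmetric_on V A" using A by (simp add: SNIP_def)
  define W where "W = V - {j}"
  have W: "finite W" "W \<subseteq> V" "j \<notin> W" "V = insert j W" using V by (auto simp: W_def)
  have symW: "symmetric_on W A" using sym W symmetric_on_subset by blast
  have nP: "\<not> parter V j A" using nullity_pair_parter[OF V(1,2) sym] A by (auto split: if_splits)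
  then have "\<And>z. z \<in> kernel_on W A \<Longrightarrow> (\<Sum>v\<in>W. A j v * z v) = 0" by (auto simp: parter_def W_def)
  from orthogonal_to_kernel_in_range[OF W(1) symW this]
  obtain w where w: "w \<in> supported_on W" "\<And>u. u \<in> W \<Longrightarrow> (\<Sum>v\<in>W. A u v * w v) = A j u" by blast
  define x where "x = (\<lambda>v. if v = j then -1 else w v)"
  \<comment> \<open>The new entry at \<open>(j, j)\<close> is exactly what makes row
    \<open>j\<close> annihilate \<open>x\<close>; the other rows do so by the choice of
    \<open>w\<close>.\<close>
  define A1 where "A1 = (\<lambda>u v. if u = j \<and> v = j then \<Sum>v\<in>W. A j v * w v else A u v)"
  have sym1: "symmetric_on V A1" using sym by (auto simp: symmetric_on_def A1_def)
  have x: "x \<in> kernel_on V A1"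
  proof -
    have "(\<Sum>v\<in>V. A1 u v * x v) = 0" if u: "u \<in> V" for u
    proof -
      have "(\<Sum>v\<in>V. A1 u v * x v) = - A1 u j + (\<Sum>v\<in>W. A1 u v * x v)"
        using W by (simp add: x_def)
      also have "(\<Sum>v\<in>W. A1 u v * x v) = (\<Sum>v\<in>W. A u v * w v)"
        using W by (intro sum.cong) (auto simp: A1_def x_def)
      finally have *: "(\<Sum>v\<in>V. A1 u v * x v) = - A1 u j + (\<Sum>v\<in>W. A u v * w v)" .
      show ?thesis
      proof (cases "u = j")
        case False
        then have "u \<in> W" "A u j = A j u" using u sym V(2) by (auto simp: W_def symmetric_on_def)
        then show ?thesis using * w(2) False by (simp add: A1_def)
      qed (use * in \<open>simp add: A1_def\<close>)
    qed
    then show ?thesis using w V by (auto simp: kernel_on_def x_def supported_on_def W_def)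
  qed
  have "parter V j A1 = parter V j A" by (rule parter_cong[OF V(2)]) (auto simp: A1_def)
  then have nP1: "\<not> parter V j A1" using nP by simp
  have "nullity W A1 = nullity W A" by (rule nullity_cong) (use W(3) in \<open>auto simp: A1_def\<close>)
  then have "nullity W A1 = m" using A(4) by (simp add: W_def)
  moreover have xj: "x j \<noteq> 0" by (simp add: x_def)
  ultimately have n1: "nullity V A1 = Suc m"
    using nullity_not_parter[OF V(1,2) nP1] x by (auto simp: W_def)
  define B where "B = (\<lambda>u v. if u = i then (if v = j then 1 else 0) else if v = i then (if u = j then 1 else 0) else A1 u v)"
  define U where "U = insert i V"
  have U: "finite U" "i \<in> U" "U - {i} = V" using V by (auto simp: U_def)
  have BV: "B u v = A1 u v" if "u \<in> V" "v \<in> V" for u v using that V by (auto simp: B_def)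
  have symB: "symmetric_on U B" using sym1 by (auto simp: symmetric_on_def B_def U_def)
  have nB: "nullity (U - {i}) B = Suc m" using n1 nullity_cong[of V B A1] BV U by simp
  have "parter U i B"
  proof -
    have "x \<in> kernel_on (U - {i}) B" using x BV U by (simp add: kernel_on_def)
    moreover have "(\<Sum>v\<in>U - {i}. B i v * x v) = x j"
      using V U by (simp add: B_def if_distrib[of "\<lambda>x. x * _"] cong: if_cong)
    ultimately show ?thesis unfolding parter_def using xj by (intro bexI[of _ x]) auto
  qed
  then have nB': "nullity U B = m" using nullity_parter[OF U(1,2) symB] nB by simp
  have snip: "SNIP U i B"
  proof (rule SNIP_I[OF symB])
    fix X a b
    assume X: "\<And>u v. u \<in> U \<Longrightarrow> v \<in> U \<Longrightarrow> X u v = X v u"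
      "\<And>u v. u \<in> U \<Longrightarrow> v \<in> U \<Longrightarrow> u = v \<or> B u v \<noteq> 0 \<Longrightarrow> X u v = 0"
      "\<And>u v. u \<in> U \<Longrightarrow> u \<noteq> i \<Longrightarrow> v \<in> U \<Longrightarrow> (\<Sum>w\<in>U. B u w * X w v) = 0"
      and ab: "a \<in> U" "b \<in> U"
    have row: "B u i * X i v + (\<Sum>w\<in>V. B u w * X w v) = 0" if "u \<in> V" "v \<in> U" for u v
      using X(3)[of u v] that V by (auto simp: U_def)
    have Z: "X u v = 0" if uv: "u \<in> V" "v \<in> V" for u v
    proof (rule SNIP_D[OF A(2)])
      fix u v assume uv: "u \<in> V" "v \<in> V"
      show "X u v = X v u" using X(1) uv U by auto
      show "X u v = 0" if "u = v \<or> A u v \<noteq> 0"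
        using X(2)[of u v] that uv U BV[of u v] by (auto simp: A1_def split: if_splits)
      show "(\<Sum>w\<in>V. A u w * X w v) = 0" if "u \<noteq> j"
      proof -
        have "(\<Sum>w\<in>V. A u w * X w v) = (\<Sum>w\<in>V. B u w * X w v)"
          using that BV uv by (intro sum.cong) (auto simp: A1_def)
        then show ?thesis using row[of u v] uv U that V by (auto simp: B_def)
      qed
    qed (use uv in auto)
    have Xi: "X i v = 0" if v: "v \<in> V" for v
    proof -
      have "(\<Sum>w\<in>V. B j w * X w v) = 0" using Z v by simp
      then show ?thesis using row[of j v] V v by (auto simp: B_def U_def)
    qed
    have "X i i = 0" using X(2)[of i i] U by auto
    then show "X a b = 0" using ab Z Xi X(1)[of a b] U by (auto simp: U_def)
  qed
  have "B \<in> sym_matrices (root_extension i H)"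
    unfolding sym_matrices_def
  proof (intro CollectI conjI ballI impI)
    show "symmetric_on (verts (root_extension i H)) B" using symB by (simp add: root_extension_def U_def V_def)
    fix u v assume uv: "u \<in> verts (root_extension i H)" "v \<in> verts (root_extension i H)" "u \<noteq> v"
    have E: "e \<in> edges H \<Longrightarrow> i \<notin> e" for e using H i by (auto simp: rooted_graph_def)
    show "(B u v \<noteq> 0) = ({u, v} \<in> edges (root_extension i H))"
    proof (cases "u = i \<or> v = i")
      case True
      then show ?thesis using uv E[of "{u, v}"] V by (auto simp: B_def root_extension_def j_def doubleton_eq_iff)
    next
      case False
      then have "u \<in> V" "v \<in> V" using uv by (auto simp: root_extension_def V_def)
      then show ?thesis
        using False A(1) uv by (auto simp: B_def A1_def root_extension_def sym_matrices_def V_def doubleton_eq_iff)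
    qed
  qed
  then show ?thesis
    unfolding allows_with_SNIP_def using snip nB nB'
    by (intro bexI[of _ B]) (auto simp: root_extension_def U_def V_def)
qed

section \<open>Existence and attainment of the maximum\<close>

text \<open>At a coordinate \<open>u\<close> where a nonzero kernel vector has largest modulus, the
  diagonal term would outweigh the rest of row \<open>u\<close>. Besides producing invertible
  matrices, this later gives independence of vectors whose pairing matrix is close to the
  identity.\<close>

lemma kernel_diagonally_dominant:
  assumes V: "finite V" and D: "\<And>u. u \<in> V \<Longrightarrow> (\<Sum>v\<in>V - {u}. \<bar>A u v\<bar>) < \<bar>A u u\<bar>"
  shows "kernel_on V A = {0}"
proof -
  have "x v = 0" if x: "x \<in> kernel_on V A" for x v
  proof (cases "v \<in> V")
    case True
    then have "Max ((\<lambda>v. \<bar>x v\<bar>) ` V) \<in> (\<lambda>v. \<bar>x v\<bar>) ` V" using V by (intro Max_in) auto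
    then obtain u where u: "u \<in> V" "\<bar>x u\<bar> = Max ((\<lambda>v. \<bar>x v\<bar>) ` V)" by auto
    have le: "\<bar>x v\<bar> \<le> \<bar>x u\<bar>" if "v \<in> V" for v using u V that by simp
    have "A u u * x u + (\<Sum>v\<in>V - {u}. A u v * x v) = 0"
      using x u sum.remove[OF V u(1), of "\<lambda>v. A u v * x v"] by (simp add: kernel_on_def)
    then have "\<bar>A u u\<bar> * \<bar>x u\<bar> = \<bar>\<Sum>v\<in>V - {u}. A u v * x v\<bar>" by (simp add: abs_mult[symmetric] add_eq_0_iff)
    also have "\<dots> \<le> (\<Sum>v\<in>V - {u}. \<bar>A u v * x v\<bar>)" by (rule sum_abs)
    also have "\<dots> \<le> (\<Sum>v\<in>V - {u}. \<bar>A u v\<bar> * \<bar>x u\<bar>)"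
      using le by (intro sum_mono) (auto simp: abs_mult intro: mult_left_mono)
    also have "\<dots> = (\<Sum>v\<in>V - {u}. \<bar>A u v\<bar>) * \<bar>x u\<bar>" by (simp add: sum_distrib_right)
    finally have "\<bar>x u\<bar> = 0" using D[OF u(1)] by (metis abs_ge_zero linorder_not_less mult_le_cancel_right order_le_less)
    then show ?thesis using le[OF True] by simp
  qed (use x in \<open>auto simp: kernel_on_def\<close>)
  then show ?thesis using fun_vs.subspace_0[OF subspace_kernel, of V A] by (auto simp: fun_eq_iff)
qed

text \<open>This makes the set in \<open>xixi\<close> nonempty. The diagonal \<open>card V\<close>
  dominates a row with at most \<open>card V - 1\<close> other entries of modulus at most 1, in
  \<open>A\<close> as in all its principal submatrices. If \<open>X i v = 0\<close>, column
  \<open>v\<close> of \<open>X\<close> is annihilated by the invertible \<open>A(i)\<close>; this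
  applies to \<open>v = i\<close> and spreads to all columns by symmetry of
  \<open>X\<close>.\<close>

lemma allows_zero_zero:
  assumes G: "rooted_graph G"
  shows "allows_with_SNIP G 0 0"
proof -
  define V i where "V = verts G" and "i = root G"
  have V: "finite V" "i \<in> V" using G by (auto simp: rooted_graph_def V_def i_def)
  define A where "A = (\<lambda>u v. if u = v then real (card V) else if {u, v} \<in> edges G then 1 else 0)"
  have sym: "symmetric_on V A" by (auto simp: symmetric_on_def A_def insert_commute)
  have ker: "kernel_on W A = {0}" if W: "W \<subseteq> V" for W
  proof (rule kernel_diagonally_dominant)
    show fW: "finite W" using W V finite_subset by blast
    fix u assume u: "u \<in> W"
    have "(\<Sum>v\<in>W - {u}. \<bar>A u v\<bar>) \<le> (\<Sum>v\<in>W - {u}. 1)" by (intro sum_mono) (auto simp: A_def)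
    also have "\<dots> = real (card (W - {u}))" by simp
    also have "\<dots> < real (card W)" using card_Diff1_less[OF fW u] by simp
    also have "\<dots> \<le> real (card V)" using W V by (simp add: card_mono)
    finally show "(\<Sum>v\<in>W - {u}. \<bar>A u v\<bar>) < \<bar>A u u\<bar>" by (simp add: A_def)
  qed
  have n: "nullity W A = 0" if "W \<subseteq> V" for W
    unfolding nullity_def ker[OF that] using fun_vs.dim_le_card[of "{0}" "{}"] by simp
  have "SNIP V i A"
  proof (rule SNIP_I[OF sym])
    fix X a b
    assume X: "\<And>u v. u \<in> V \<Longrightarrow> v \<in> V \<Longrightarrow> X u v = X v u"
      "\<And>u v. u \<in> V \<Longrightarrow> v \<in> V \<Longrightarrow> u = v \<or> A u v \<noteq> 0 \<Longrightarrow> X u v = 0"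
      "\<And>u v. u \<in> V \<Longrightarrow> u \<noteq> i \<Longrightarrow> v \<in> V \<Longrightarrow> (\<Sum>w\<in>V. A u w * X w v) = 0"
      and ab: "a \<in> V" "b \<in> V"
    have col: "X u v = 0" if "u \<in> V" "v \<in> V" "X i v = 0" for u v
    proof -
      have "(\<lambda>u. if u \<in> V - {i} then X u v else 0) \<in> kernel_on (V - {i}) A"
        unfolding kernel_on_def using X(3)[of _ v] sum.remove[OF V, of "\<lambda>w. A _ w * X w v"] that by auto
      then have "(\<lambda>u. if u \<in> V - {i} then X u v else 0) = 0" using ker[of "V - {i}"] by auto
      then show ?thesis using that by (cases "u = i") (auto simp: fun_eq_iff split: if_splits)
    qed
    have "X i i = 0" using X(2)[of i i] V by auto
    then have "X i b = 0" using col[of b i] X(1)[of b i] V ab by auto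
    then show "X a b = 0" using col ab by auto
  qed
  moreover have "A \<in> sym_matrices G" using sym by (auto simp: sym_matrices_def A_def V_def)
  ultimately show ?thesis unfolding allows_with_SNIP_def using n[of V] n[of "V - {i}"]
    by (intro bexI[of _ A]) (auto simp: V_def i_def)
qed

lemma finite_xixi_set:
  assumes "rooted_graph G"
  shows "finite {k + l | k l. k \<le> l \<and> allows_with_SNIP G k l}"
proof (rule finite_subset)
  show "{k + l | k l. k \<le> l \<and> allows_with_SNIP G k l} \<subseteq> {..2 * card (verts G)}"
  proof
    fix s assume "s \<in> {k + l | k l. k \<le> l \<and> allows_with_SNIP G k l}"
    then obtain k l where "s = k + l" "k \<le> l" "allows_with_SNIP G k l" by auto
    moreover from this obtain A where "nullity (verts G - {root G}) A = l"
      by (auto simp: allows_with_SNIP_def)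
    moreover have "nullity (verts G - {root G}) A \<le> card (verts G)"
      using nullity_le_card[of "verts G - {root G}" A] card_mono[of "verts G" "verts G - {root G}"] assms
      by (auto simp: rooted_graph_def)
    ultimately show "s \<in> {..2 * card (verts G)}" by auto
  qed
qed simp

lemma le_xixi:
  assumes G: "rooted_graph G" and kl: "allows_with_SNIP G k l" "k \<le> l"
  shows "k + l \<le> xixi G"
proof -
  have "k + l \<in> {k + l | k l. k \<le> l \<and> allows_with_SNIP G k l}"
    by (intro CollectI exI[of _ k] exI[of _ l] conjI refl kl)
  then show ?thesis unfolding xixi_def by (rule Max_ge[OF finite_xixi_set[OF G]])
qed

lemma xixi_attained:
  assumes G: "rooted_graph G"
  obtains m where "allows_with_SNIP G m m" "xixi G = 2 * m"
    | m where "allows_with_SNIP G m (Suc m)" "xixi G = 2 * m + 1"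
proof -
  have "xixi G \<in> {k + l | k l. k \<le> l \<and> allows_with_SNIP G k l}"
    unfolding xixi_def using finite_xixi_set[OF G] allows_zero_zero[OF G] by (intro Max_in) auto
  then obtain k l where kl: "xixi G = k + l" "k \<le> l" "allows_with_SNIP G k l" by blast
  then obtain A where A: "SNIP (verts G) (root G) A" "nullity (verts G) A = k" "nullity (verts G - {root G}) A = l"
    by (auto simp: allows_with_SNIP_def)
  have "l = k \<or> l = Suc k"
    using nullity_pair_parter[of "verts G" "root G" A] A kl(2) G
    by (auto simp: SNIP_def rooted_graph_def split: if_splits)
  then show ?thesis
  proof
    assume "l = k"
    with kl show ?thesis by (intro that(1)[of k]) simp_all
  next
    assume "l = Suc k"
    with kl show ?thesis by (intro that(2)[of k]) simp_all
  qed
qed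

section \<open>Perturbing a matrix with the SNIP\<close>

text \<open>Bolzano-Weierstrass, one coordinate at a time. Convergence is stated on the finite set
  \<open>I\<close> only, since the points used below are functions of which only these coordinates
  matter.\<close>

lemma bounded_family_convergent_subseq:
  fixes f :: "nat \<Rightarrow> 'b \<Rightarrow> real"
  assumes "finite I" "\<forall>n. \<forall>i\<in>I. \<bar>f n i\<bar> \<le> C"
  shows "\<exists>r g. strict_mono r \<and> (\<forall>i\<in>I. (\<lambda>n. f (r n) i) \<longlonglongrightarrow> g i)"
  using assms
proof (induction I rule: finite_induct)
  case empty
  then show ?case by (auto intro: exI[of _ id] strict_mono_id)
next
  case (insert x I)
  then obtain r g where r: "strict_mono r" "\<forall>i\<in>I. (\<lambda>n. f (r n) i) \<longlonglongrightarrow> g i" by auto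
  obtain s where s: "strict_mono s" "monoseq (\<lambda>n. f (r (s n)) x)"
    using seq_monosub[of "\<lambda>n. f (r n) x"] by auto
  have "Bseq (\<lambda>n. f (r (s n)) x)" using insert.prems by (intro BseqI'[of _ C]) auto
  then obtain L where L: "(\<lambda>n. f (r (s n)) x) \<longlonglongrightarrow> L"
    using Bseq_monoseq_convergent s(2) by (auto simp: convergent_def)
  have "(\<lambda>n. f (r (s n)) i) \<longlonglongrightarrow> (g(x := L)) i" if "i \<in> insert x I" for i
    using that L LIMSEQ_subseq_LIMSEQ[OF r(2)[rule_format] s(1), of i] by (auto simp: o_def)
  moreover have "strict_mono (\<lambda>n. r (s n))" using r(1) s(1) by (simp add: strict_mono_def)
  ultimately show ?case by (intro exI[of _ "\<lambda>n. r (s n)"] exI[of _ "g(x := L)"]) blast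
qed

text \<open>Ekeland's variational principle. In finite dimension the minimum of
  \<open>\<phi> x + \<kappa> * (\<Sum>i\<in>I. \<bar>x i - x0 i\<bar>)\<close> is attained, and the minimizer does the job.\<close>
lemma ekeland_finite:
  fixes \<phi> :: "('b \<Rightarrow> real) \<Rightarrow> real"
  assumes I: "finite I" and nonneg: "\<And>x. 0 \<le> \<phi> x"
    and cont: "\<And>xs g. \<forall>i\<in>I. (\<lambda>n. xs n i) \<longlonglongrightarrow> g i \<Longrightarrow> (\<lambda>n. \<phi> (xs n)) \<longlonglongrightarrow> \<phi> g"
    and closed: "\<And>xs g. \<forall>n. xs n \<in> S \<Longrightarrow> \<forall>i\<in>I. (\<lambda>n. xs n i) \<longlonglongrightarrow> g i \<Longrightarrow> g \<in> S"
    and x0: "x0 \<in> S" and \<kappa>: "0 < \<kappa>"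
  shows "\<exists>x\<in>S. \<phi> x + \<kappa> * (\<Sum>i\<in>I. \<bar>x i - x0 i\<bar>) \<le> \<phi> x0 \<and> (\<forall>y\<in>S. \<phi> x \<le> \<phi> y + \<kappa> * (\<Sum>i\<in>I. \<bar>y i - x i\<bar>))"
proof -
  define \<Psi> where "\<Psi> x = \<phi> x + \<kappa> * (\<Sum>i\<in>I. \<bar>x i - x0 i\<bar>)" for x
  have \<Psi>0: "0 \<le> \<Psi> x" for x using nonneg[of x] \<kappa> by (simp add: \<Psi>_def sum_nonneg)
  define m where "m = Inf (\<Psi> ` S)"
  have bdd: "bdd_below (\<Psi> ` S)" using \<Psi>0 by (auto intro: bdd_belowI[of _ 0])
  have m_le: "m \<le> \<Psi> y" if "y \<in> S" for y unfolding m_def using that bdd by (auto intro: cInf_lower)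
  have "\<exists>x\<in>S. \<Psi> x < m + inverse (real (Suc n))" for n
    using cInf_lessD[of "\<Psi> ` S" "m + inverse (real (Suc n))"] x0 by (auto simp: m_def)
  then obtain xs where xs: "\<And>n. xs n \<in> S" "\<And>n. \<Psi> (xs n) < m + inverse (real (Suc n))" by metis
  \<comment> \<open>Since \<open>\<phi>\<close> is nonnegative, the penalty alone confines a
    minimizing sequence to a bounded region.\<close>
  have "\<bar>xs n i\<bar> \<le> (\<Sum>i\<in>I. \<bar>x0 i\<bar>) + (m + 1) / \<kappa>" if i: "i \<in> I" for n i
  proof -
    have "inverse (real (Suc n)) \<le> 1" by (simp add: inverse_le_1_iff)
    then have "\<Psi> (xs n) \<le> m + 1" using xs(2)[of n] by linarith
    then have "\<kappa> * (\<Sum>i\<in>I. \<bar>xs n i - x0 i\<bar>) \<le> m + 1" using nonneg[of "xs n"] by (simp add: \<Psi>_def)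
    then have "(\<Sum>i\<in>I. \<bar>xs n i - x0 i\<bar>) \<le> (m + 1) / \<kappa>" using \<kappa> by (simp add: field_simps)
    moreover have "\<bar>xs n i - x0 i\<bar> \<le> (\<Sum>i\<in>I. \<bar>xs n i - x0 i\<bar>)"
      by (rule member_le_sum[OF i _ I, of "\<lambda>i. \<bar>xs n i - x0 i\<bar>"]) auto
    moreover have "\<bar>x0 i\<bar> \<le> (\<Sum>i\<in>I. \<bar>x0 i\<bar>)"
      by (rule member_le_sum[OF i _ I, of "\<lambda>i. \<bar>x0 i\<bar>"]) auto
    ultimately show ?thesis by linarith
  qed
  then have "\<forall>n. \<forall>i\<in>I. \<bar>xs n i\<bar> \<le> (\<Sum>i\<in>I. \<bar>x0 i\<bar>) + (m + 1) / \<kappa>" by blast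
  from bounded_family_convergent_subseq[OF I this]
  obtain r g where r: "strict_mono r" "\<forall>i\<in>I. (\<lambda>n. xs (r n) i) \<longlonglongrightarrow> g i" by blast
  have gS: "g \<in> S" using closed[of "\<lambda>n. xs (r n)" g] xs r by auto
  have lim: "(\<lambda>n. \<Psi> (xs (r n))) \<longlonglongrightarrow> \<Psi> g"
    unfolding \<Psi>_def using r(2) cont[of "\<lambda>n. xs (r n)" g] by (intro tendsto_intros) auto
  have up: "(\<lambda>n. m + inverse (real (Suc n))) \<longlonglongrightarrow> m + 0"
    by (intro tendsto_add tendsto_const LIMSEQ_inverse_real_of_nat)
  have "\<Psi> (xs (r n)) \<le> m + inverse (real (Suc n))" for n
  proof -
    have "inverse (real (Suc (r n))) \<le> inverse (real (Suc n))" using seq_suble[OF r(1), of n] by (intro le_imp_inverse_le) auto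
    then show ?thesis using xs(2)[of "r n"] by linarith
  qed
  then have "\<Psi> g \<le> m + 0" by (intro LIMSEQ_le[OF lim up]) auto
  then have min: "\<Psi> g \<le> \<Psi> y" if "y \<in> S" for y using m_le[OF that] by linarith
  have "\<phi> g \<le> \<phi> y + \<kappa> * (\<Sum>i\<in>I. \<bar>y i - g i\<bar>)" if "y \<in> S" for y
  proof -
    have "(\<Sum>i\<in>I. \<bar>y i - x0 i\<bar>) \<le> (\<Sum>i\<in>I. \<bar>y i - g i\<bar> + \<bar>g i - x0 i\<bar>)" by (intro sum_mono) auto
    then have "\<kappa> * (\<Sum>i\<in>I. \<bar>y i - x0 i\<bar>) \<le> \<kappa> * ((\<Sum>i\<in>I. \<bar>y i - g i\<bar>) + (\<Sum>i\<in>I. \<bar>g i - x0 i\<bar>))"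
      using \<kappa> by (intro mult_left_mono) (auto simp: sum.distrib)
    then show ?thesis using min[OF that] by (simp add: \<Psi>_def distrib_left)
  qed
  moreover have "\<phi> g + \<kappa> * (\<Sum>i\<in>I. \<bar>g i - x0 i\<bar>) \<le> \<phi> x0" using min[OF x0] by (simp add: \<Psi>_def)
  ultimately show ?thesis using gS by blast
qed

text \<open>\<open>P + 2 * t * Q + t\<^sup>2 * N\<close> is the squared length of a residual moved
  along a line, and \<open>Q / sqrt P\<close> is the derivative of its length at
  \<open>t = 0\<close>. A length that decreases with slope at most \<open>c\<close> in either
  direction bounds this derivative.\<close>

lemma quadratic_slope_bound:
  fixes P Q N c :: real
  assumes P: "0 < P" and c: "0 \<le> c" and N: "0 \<le> N"
    and pos: "\<And>t. 0 \<le> P + 2 * t * Q + t\<^sup>2 * N"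
    and le: "\<And>t. sqrt P \<le> sqrt (P + 2 * t * Q + t\<^sup>2 * N) + c * \<bar>t\<bar>"
  shows "\<bar>Q\<bar> \<le> c * sqrt P"
proof (rule ccontr)
  assume no: "\<not> ?thesis"
  define \<delta> where "\<delta> = \<bar>Q\<bar> - c * sqrt P"
  have \<delta>: "0 < \<delta>" using no by (simp add: \<delta>_def)
  \<comment> \<open>The first bound keeps \<open>sqrt P - c * \<tau>\<close> nonnegative, so that
    squaring is allowed; the second keeps the quadratic term below the linear gain. The denominators
    \<open>c + 1\<close> and \<open>N + 1\<close> cover \<open>c = 0\<close> and
    \<open>N = 0\<close>.\<close>
  define \<tau> where "\<tau> = min (sqrt P / (c + 1)) (\<delta> / (N + 1))"
  have "0 < sqrt P / (c + 1)" "0 < \<delta> / (N + 1)" using \<delta> P c N by auto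
  then have "0 < \<tau>" by (simp add: \<tau>_def)
  moreover have "\<tau> \<le> sqrt P / (c + 1)" "\<tau> \<le> \<delta> / (N + 1)" by (auto simp: \<tau>_def)
  ultimately have \<tau>: "0 < \<tau>" "\<tau> * (c + 1) \<le> sqrt P" "\<tau> * (N + 1) \<le> \<delta>"
    using c N by (simp_all add: pos_le_divide_eq)
  define t where "t = (if 0 \<le> Q then - \<tau> else \<tau>)"
  have t: "t * Q = - (\<tau> * \<bar>Q\<bar>)" "\<bar>t\<bar> = \<tau>" "t\<^sup>2 = \<tau>\<^sup>2" using \<tau> by (auto simp: t_def)
  have "0 \<le> sqrt P - c * \<tau>" using \<tau> by (simp add: algebra_simps)
  moreover have "sqrt P - c * \<tau> \<le> sqrt (P + 2 * t * Q + t\<^sup>2 * N)" using le[of t] t by simp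
  ultimately have "(sqrt P - c * \<tau>)\<^sup>2 \<le> (sqrt (P + 2 * t * Q + t\<^sup>2 * N))\<^sup>2" by (intro power_mono) auto
  also have "\<dots> = P + 2 * t * Q + t\<^sup>2 * N" using pos[of t] by simp
  also have "\<dots> = P - 2 * \<tau> * \<bar>Q\<bar> + \<tau>\<^sup>2 * N" using t by (simp add: mult.assoc)
  finally have "P - 2 * c * \<tau> * sqrt P + (c * \<tau>)\<^sup>2 \<le> P - 2 * \<tau> * \<bar>Q\<bar> + \<tau>\<^sup>2 * N"
    using P by (simp add: power2_diff mult_ac)
  moreover have "2 * \<tau> * \<delta> = 2 * \<tau> * \<bar>Q\<bar> - 2 * c * \<tau> * sqrt P" by (simp add: \<delta>_def algebra_simps)
  ultimately have "2 * \<tau> * \<delta> \<le> \<tau>\<^sup>2 * N"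
    using zero_le_power2[of "c * \<tau>"] by linarith
  then have "\<tau> * (2 * \<delta>) \<le> \<tau> * (\<tau> * N)" by (simp add: power2_eq_square mult_ac)
  then have "2 * \<delta> \<le> \<tau> * N" using \<tau> by simp
  moreover have "\<tau> * N \<le> \<delta>" using \<tau> by (simp add: algebra_simps)
  ultimately show False using \<delta> by linarith
qed

text \<open>The SNIP is an open condition. Violating matrices, scaled to total modulus 1, have a
  limit point that violates the SNIP of \<open>A\<close>: an entry forced to zero by
  \<open>A\<close> is forced to zero by \<open>B n\<close> for large \<open>n\<close>, and the
  scaling keeps the limit nonzero.\<close>

lemma eventually_SNIP:
  assumes V: "finite V" and A: "SNIP V i A" and B: "\<And>n. symmetric_on V (B n)"
    and lim: "\<And>u v. u \<in> V \<Longrightarrow> v \<in> V \<Longrightarrow> (\<lambda>n. B n u v) \<longlonglongrightarrow> A u v"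
  shows "\<forall>\<^sub>F n in sequentially. SNIP V i (B n)"
proof (rule ccontr)
  assume "\<not> ?thesis"
  then obtain r :: "nat \<Rightarrow> nat" where r: "strict_mono r" "\<forall>n. \<not> SNIP V i (B (r n))"
    using not_eventually_sequentiallyD by blast
  have limr: "(\<lambda>n. B (r n) u v) \<longlonglongrightarrow> A u v" if "u \<in> V" "v \<in> V" for u v
    using LIMSEQ_subseq_LIMSEQ[OF lim[OF that] r(1)] by (simp add: o_def)
  have "\<exists>Z. (\<forall>u\<in>V. \<forall>v\<in>V. Z (u, v) = Z (v, u)) \<and> (\<forall>u\<in>V. \<forall>v\<in>V. u = v \<or> B (r n) u v \<noteq> 0 \<longrightarrow> Z (u, v) = 0) \<and>
    (\<forall>u\<in>V - {i}. \<forall>v\<in>V. (\<Sum>w\<in>V. B (r n) u w * Z (w, v)) = 0) \<and> (\<Sum>p\<in>V \<times> V. \<bar>Z p\<bar>) = (1::real)" for n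
  proof -
    have "\<not> SNIP V i (B (r n))" "symmetric_on V (B (r n))" using r(2) B by auto
    then obtain X where X': "symmetric_on V X" "zero_on V V (entrywise_prod (B (r n)) X)"
      "zero_on V V (entrywise_prod id_matrix X)" "zero_on (V - {i}) V (matrix_prod_on V (B (r n)) X)"
      "\<not> zero_on V V X" unfolding SNIP_def by blast
    have X: "\<forall>u\<in>V. \<forall>v\<in>V. X u v = X v u"
      "\<forall>u\<in>V - {i}. \<forall>v\<in>V. (\<Sum>w\<in>V. B (r n) u w * X w v) = 0" "\<exists>u\<in>V. \<exists>v\<in>V. X u v \<noteq> 0"
      using X'(1,4,5) by (simp_all add: symmetric_on_def zero_on_def matrix_prod_on_def)
    have Xp: "X u v = 0" if "u \<in> V" "v \<in> V" "u = v \<or> B (r n) u v \<noteq> 0" for u v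
    proof -
      have "B (r n) u v * X u v = 0" "id_matrix u v * X u v = 0"
        using X'(2,3) that by (simp_all add: zero_on_def entrywise_prod_def)
      then show ?thesis using that(3) by (auto simp: id_matrix_def)
    qed
    define s where "s = (\<Sum>p\<in>V \<times> V. \<bar>X (fst p) (snd p)\<bar>)"
    have "s \<noteq> 0"
    proof
      assume "s = 0"
      then have "\<forall>p\<in>V \<times> V. \<bar>X (fst p) (snd p)\<bar> = 0" unfolding s_def using V by (subst (asm) sum_nonneg_eq_0_iff) auto
      then show False using X(3) by auto
    qed
    moreover have "0 \<le> s" by (simp add: s_def sum_nonneg)
    ultimately have s: "0 < s" by simp
    have "(\<Sum>p\<in>V \<times> V. \<bar>X (fst p) (snd p) / s\<bar>) = s / s" using s by (simp add: s_def abs_divide flip: sum_divide_distrib)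
    moreover have "(\<Sum>w\<in>V. B (r n) u w * (X w v / s)) = 0" if "u \<in> V - {i}" "v \<in> V" for u v
      using X(2) that by (simp flip: sum_divide_distrib)
    ultimately show ?thesis
      using X(1) Xp s by (intro exI[of _ "\<lambda>p. X (fst p) (snd p) / s"]) auto
  qed
  then have "\<forall>n. \<exists>Z. (\<forall>u\<in>V. \<forall>v\<in>V. Z (u, v) = Z (v, u)) \<and> (\<forall>u\<in>V. \<forall>v\<in>V. u = v \<or> B (r n) u v \<noteq> 0 \<longrightarrow> Z (u, v) = 0) \<and>
    (\<forall>u\<in>V - {i}. \<forall>v\<in>V. (\<Sum>w\<in>V. B (r n) u w * Z (w, v)) = 0) \<and> (\<Sum>p\<in>V \<times> V. \<bar>Z p\<bar>) = (1::real)" by blast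
  from choice[OF this] obtain Z where "\<forall>n. (\<forall>u\<in>V. \<forall>v\<in>V. Z n (u, v) = Z n (v, u)) \<and>
    (\<forall>u\<in>V. \<forall>v\<in>V. u = v \<or> B (r n) u v \<noteq> 0 \<longrightarrow> Z n (u, v) = 0) \<and>
    (\<forall>u\<in>V - {i}. \<forall>v\<in>V. (\<Sum>w\<in>V. B (r n) u w * Z n (w, v)) = 0) \<and> (\<Sum>p\<in>V \<times> V. \<bar>Z n p\<bar>) = (1::real)" ..
  then have Z: "\<And>n u v. u \<in> V \<Longrightarrow> v \<in> V \<Longrightarrow> Z n (u, v) = Z n (v, u)"
    "\<And>n u v. u \<in> V \<Longrightarrow> v \<in> V \<Longrightarrow> u = v \<or> B (r n) u v \<noteq> 0 \<Longrightarrow> Z n (u, v) = 0"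
    "\<And>n u v. u \<in> V - {i} \<Longrightarrow> v \<in> V \<Longrightarrow> (\<Sum>w\<in>V. B (r n) u w * Z n (w, v)) = 0"
    "\<And>n. (\<Sum>p\<in>V \<times> V. \<bar>Z n p\<bar>) = (1::real)" by blast+
  have fin: "finite (V \<times> V)" using V by simp
  have "\<bar>Z n p\<bar> \<le> 1" if "p \<in> V \<times> V" for n p
    using member_le_sum[OF that _ fin, of "\<lambda>p. \<bar>Z n p\<bar>"] Z(4)[of n] by simp
  then have "\<forall>n. \<forall>p\<in>V \<times> V. \<bar>Z n p\<bar> \<le> 1" by blast
  from bounded_family_convergent_subseq[OF fin this]
  obtain q L where q: "strict_mono q" "\<forall>p\<in>V \<times> V. (\<lambda>n. Z (q n) p) \<longlonglongrightarrow> L p" by blast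
  then have L: "(\<lambda>n. Z (q n) (u, v)) \<longlonglongrightarrow> L (u, v)" if "u \<in> V" "v \<in> V" for u v using that by auto
  have limq: "(\<lambda>n. B (r (q n)) u v) \<longlonglongrightarrow> A u v" if "u \<in> V" "v \<in> V" for u v
    using LIMSEQ_subseq_LIMSEQ[OF limr[OF that] q(1)] by (simp add: o_def)
  have "L (u, v) = 0" if uv: "u \<in> V" "v \<in> V" for u v
  proof (rule SNIP_D[OF A, where X = "\<lambda>u v. L (u, v)"])
    fix u v assume uv: "u \<in> V" "v \<in> V"
    show "L (u, v) = L (v, u)"
    proof (rule LIMSEQ_unique[OF L[OF uv]])
      show "(\<lambda>n. Z (q n) (u, v)) \<longlonglongrightarrow> L (v, u)" using L[OF uv(2,1)] Z(1)[OF uv] by simp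
    qed
    show "L (u, v) = 0" if "u = v \<or> A u v \<noteq> 0"
    proof -
      have "\<forall>\<^sub>F n in sequentially. u = v \<or> B (r (q n)) u v \<noteq> 0"
      proof (cases "u = v")
        case False
        then have "\<forall>\<^sub>F n in sequentially. B (r (q n)) u v \<noteq> 0"
          using that by (intro tendsto_imp_eventually_ne[OF limq[OF uv]]) auto
        then show ?thesis by eventually_elim simp
      qed simp
      then have "\<forall>\<^sub>F n in sequentially. Z (q n) (u, v) = 0"
        by eventually_elim (use Z(2)[OF uv] in blast)
      then have "(\<lambda>n. Z (q n) (u, v)) \<longlonglongrightarrow> 0" by (rule tendsto_eventually)
      then show ?thesis using LIMSEQ_unique L[OF uv] by blast
    qed
    show "(\<Sum>w\<in>V. A u w * L (w, v)) = 0" if "u \<noteq> i"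
    proof (rule LIMSEQ_unique)
      show "(\<lambda>n. \<Sum>w\<in>V. B (r (q n)) u w * Z (q n) (w, v)) \<longlonglongrightarrow> (\<Sum>w\<in>V. A u w * L (w, v))"
        by (intro tendsto_sum tendsto_mult limq L uv)
      show "(\<lambda>n. \<Sum>w\<in>V. B (r (q n)) u w * Z (q n) (w, v)) \<longlonglongrightarrow> 0" using Z(3) uv that by simp
    qed
  qed (use uv in auto)
  moreover have "(\<Sum>p\<in>V \<times> V. \<bar>L p\<bar>) = 1"
  proof (rule LIMSEQ_unique)
    show "(\<lambda>n. \<Sum>p\<in>V \<times> V. \<bar>Z (q n) p\<bar>) \<longlonglongrightarrow> (\<Sum>p\<in>V \<times> V. \<bar>L p\<bar>)"
      using q(2) by (intro tendsto_sum tendsto_rabs) auto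
    show "(\<lambda>n. \<Sum>p\<in>V \<times> V. \<bar>Z (q n) p\<bar>) \<longlonglongrightarrow> 1" using Z(4) by simp
  qed
  ultimately show False by (simp add: sum.neutral)
qed

text \<open>The matrix with entries \<open>\<Sum>j<m. R j u * X j v + X j u * R j v\<close> satisfies the equations
  of the SNIP, so it vanishes. Hence \<open>R\<close> is an antisymmetric combination of the \<open>X j\<close>, and
  the symmetry hypothesis \<open>c\<close> leaves only \<open>R = 0\<close>.\<close>
lemma stationary_residual_zero:
  fixes X Y R :: "nat \<Rightarrow> 'a \<Rightarrow> real"
  assumes V: "finite V" "i \<in> V" and A: "SNIP V i A"
    and X: "\<And>j u. j < m \<Longrightarrow> u \<in> V \<Longrightarrow> (\<Sum>v\<in>V. A u v * X j v) = 0"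
    and Y: "\<And>j l. j < m \<Longrightarrow> l < m \<Longrightarrow> (\<Sum>v\<in>V. Y j v * X l v) = (if j = l then 1 else 0)"
    and a: "\<And>u v. u \<in> V \<Longrightarrow> v \<in> V \<Longrightarrow> u = v \<or> A u v \<noteq> 0 \<Longrightarrow> (\<Sum>j<m. R j u * X j v + X j u * R j v) = 0"
    and b: "\<And>j u. j < m \<Longrightarrow> u \<in> V - {i} \<Longrightarrow> (\<Sum>v\<in>V. A u v * R j v) = 0"
    and c: "\<And>j l. j < m \<Longrightarrow> l < m \<Longrightarrow> (\<Sum>u\<in>V. R j u * X l u) = (\<Sum>u\<in>V. R l u * X j u)"
    and ju: "j < m" "u \<in> V"
  shows "R j u = 0"
proof -
  define M where "M u v = (\<Sum>j<m. R j u * X j v + X j u * R j v)" for u v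
  have M0: "M u v = 0" if uv: "u \<in> V" "v \<in> V" for u v
  proof (rule SNIP_D[OF A])
    fix u v assume uv: "u \<in> V" "v \<in> V"
    show "M u v = M v u" unfolding M_def by (intro sum.cong) auto
    show "M u v = 0" if "u = v \<or> A u v \<noteq> 0" using a[OF uv that] by (simp add: M_def)
    show "(\<Sum>w\<in>V. A u w * M w v) = 0" if "u \<noteq> i"
    proof -
      have "(\<Sum>w\<in>V. A u w * M w v) = (\<Sum>w\<in>V. \<Sum>j<m. A u w * R j w * X j v + A u w * X j w * R j v)"
        by (simp add: M_def sum_distrib_left algebra_simps)
      also have "\<dots> = (\<Sum>j<m. \<Sum>w\<in>V. A u w * R j w * X j v + A u w * X j w * R j v)" by (rule sum.swap)
      also have "\<dots> = (\<Sum>j<m. (\<Sum>w\<in>V. A u w * R j w) * X j v + (\<Sum>w\<in>V. A u w * X j w) * R j v)"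
        by (simp add: sum.distrib sum_distrib_right)
      also have "\<dots> = 0" using X b uv that by (intro sum.neutral) auto
      finally show ?thesis .
    qed
  qed (use uv in auto)
  \<comment> \<open>Contracting \<open>M = 0\<close> with \<open>Y l\<close> isolates
    \<open>R l\<close>; what remains is a combination of the \<open>X j\<close> with these
    coefficients.\<close>
  define S where "S l j = - (\<Sum>v\<in>V. R j v * Y l v)" for l j
  have MY: "(\<Sum>v\<in>V. M u v * Y l v) = R l u - (\<Sum>j<m. S l j * X j u)" if "l < m" for u l
  proof -
    have "(\<Sum>v\<in>V. M u v * Y l v) = (\<Sum>v\<in>V. \<Sum>j<m. R j u * (Y l v * X j v) + X j u * (R j v * Y l v))"
      by (simp add: M_def sum_distrib_left sum_distrib_right algebra_simps)
    also have "\<dots> = (\<Sum>j<m. \<Sum>v\<in>V. R j u * (Y l v * X j v) + X j u * (R j v * Y l v))" by (rule sum.swap)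
    also have "\<dots> = (\<Sum>j<m. R j u * (\<Sum>v\<in>V. Y l v * X j v) - S l j * X j u)"
      by (simp add: S_def sum.distrib sum_distrib_left mult_ac)
    also have "\<dots> = (\<Sum>j<m. R j u * (if l = j then 1 else 0) - S l j * X j u)"
      using Y that by (intro sum.cong) auto
    also have "\<dots> = R l u - (\<Sum>j<m. S l j * X j u)"
      using that by (simp add: sum_subtractf if_distrib[of "\<lambda>x. _ * x"] cong: if_cong)
    finally show ?thesis .
  qed
  have R: "R l u = (\<Sum>j<m. S l j * X j u)" if "l < m" "u \<in> V" for l u
    using MY[OF that(1), of u] M0[OF that(2)] by simp
  \<comment> \<open>The pairing of \<open>Y p\<close> with \<open>R l\<close> is computed twice:
    from the definition of \<open>S\<close> and from the expansion of \<open>R l\<close> in the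
    \<open>X j\<close>.\<close>
  have anti: "S l p = - S p l" if "l < m" "p < m" for l p
  proof -
    have "- S p l = (\<Sum>u\<in>V. Y p u * R l u)" by (simp add: S_def mult.commute)
    also have "\<dots> = (\<Sum>u\<in>V. \<Sum>j<m. S l j * (Y p u * X j u))"
      using R[OF that(1)] by (simp add: sum_distrib_left mult_ac)
    also have "\<dots> = (\<Sum>j<m. \<Sum>u\<in>V. S l j * (Y p u * X j u))" by (rule sum.swap)
    also have "\<dots> = (\<Sum>j<m. S l j * (if p = j then 1 else 0))"
      using Y that by (intro sum.cong) (auto simp flip: sum_distrib_left)
    also have "\<dots> = S l p" using that by (simp add: if_distrib[of "\<lambda>x. _ * x"] cong: if_cong)
    finally show ?thesis by simp
  qed
  \<comment> \<open>\<open>C\<close> is symmetric by hypothesis \<open>c\<close> and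
    \<open>S\<close> is antisymmetric, so their pairing \<open>E\<close> is zero; by the expansion
    of \<open>R\<close> it is also the sum of all squares \<open>(R l u)\<^sup>2\<close>.\<close>
  define C where "C l j = (\<Sum>u\<in>V. R l u * X j u)" for l j
  define E where "E = (\<Sum>l<m. \<Sum>j<m. S l j * C l j)"
  have "E = (\<Sum>j<m. \<Sum>l<m. S l j * C l j)" unfolding E_def by (rule sum.swap)
  also have "\<dots> = (\<Sum>j<m. \<Sum>l<m. - (S j l * C j l))"
  proof (intro sum.cong refl)
    fix j l assume jl: "j \<in> {..<m}" "l \<in> {..<m}"
    then have "S l j = - S j l" by (intro anti) auto
    moreover have "C l j = C j l" using jl c[of l j] by (simp add: C_def)
    ultimately show "S l j * C l j = - (S j l * C j l)" by simp
  qed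
  also have "\<dots> = - E" by (simp add: E_def sum_negf)
  finally have "E = 0" by simp
  moreover have "(\<Sum>l<m. \<Sum>u\<in>V. (R l u)\<^sup>2) = E"
  proof -
    have "(\<Sum>u\<in>V. (R l u)\<^sup>2) = (\<Sum>j<m. S l j * C l j)" if l: "l < m" for l
    proof -
      have "(\<Sum>u\<in>V. (R l u)\<^sup>2) = (\<Sum>u\<in>V. R l u * (\<Sum>j<m. S l j * X j u))"
        using R[OF l] by (intro sum.cong) (auto simp: power2_eq_square)
      also have "\<dots> = (\<Sum>u\<in>V. \<Sum>j<m. S l j * (R l u * X j u))" by (simp add: sum_distrib_left mult_ac)
      also have "\<dots> = (\<Sum>j<m. \<Sum>u\<in>V. S l j * (R l u * X j u))" by (rule sum.swap)
      finally show ?thesis by (simp add: C_def sum_distrib_left)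
    qed
    then show ?thesis by (simp add: E_def)
  qed
  ultimately have "(\<Sum>l<m. \<Sum>u\<in>V. (R l u)\<^sup>2) = 0" by simp
  then have "(\<Sum>u\<in>V. (R j u)\<^sup>2) = 0"
    using ju by (subst (asm) sum_nonneg_eq_0_iff) (auto simp: sum_nonneg)
  then show ?thesis using ju V by (subst (asm) sum_nonneg_eq_0_iff) auto
qed

text \<open>A point \<open>x\<close> packs a symmetric matrix (the entries \<open>x (Inl u, v)\<close>) and \<open>m\<close> vectors
  (the entries \<open>x (Inr j, v)\<close>). The residual vanishes when the matrix maps the vectors with
  index \<open>j > 0\<close> to 0 and the vector with index 0 to \<open>\<epsilon>\<close> times the unit vector at \<open>i\<close>.\<close>

definition residual :: "'a set \<Rightarrow> 'a \<Rightarrow> real \<Rightarrow> (('a + nat) \<times> 'a \<Rightarrow> real) \<Rightarrow> nat \<Rightarrow> 'a \<Rightarrow> real" where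
  "residual V i \<epsilon> x j u = (\<Sum>v\<in>V. x (Inl u, v) * x (Inr j, v)) - (if j = 0 \<and> u = i then \<epsilon> else 0)"

definition residual_norm :: "'a set \<Rightarrow> 'a \<Rightarrow> nat \<Rightarrow> real \<Rightarrow> (('a + nat) \<times> 'a \<Rightarrow> real) \<Rightarrow> real" where
  "residual_norm V i m \<epsilon> x = sqrt (\<Sum>j<m. \<Sum>u\<in>V. (residual V i \<epsilon> x j u)\<^sup>2)"

text \<open>The first-order part of the residual at \<open>x\<close> in direction \<open>h\<close>:
  the product rule for matrix times vector, in which the constant \<epsilon> drops out.\<close>

definition variation :: "'a set \<Rightarrow> (('a + nat) \<times> 'a \<Rightarrow> real) \<Rightarrow> (('a + nat) \<times> 'a \<Rightarrow> real) \<Rightarrow> nat \<Rightarrow> 'a \<Rightarrow> real" where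
  "variation V x h j u = (\<Sum>v\<in>V. h (Inl u, v) * x (Inr j, v) + x (Inl u, v) * h (Inr j, v))"

text \<open>Only the zeros of the pattern are imposed, which makes this a linear subspace closed
  under limits of coordinates; entries that are nonzero in \<open>A\<close> stay so close to
  \<open>A\<close>. Diagonal entries are free, and vanishing at \<open>i\<close> makes the vectors
  candidates for the kernel of \<open>A(i)\<close>.\<close>

definition feasible :: "'a set \<Rightarrow> 'a \<Rightarrow> nat \<Rightarrow> 'a matrix \<Rightarrow> (('a + nat) \<times> 'a \<Rightarrow> real) set" where
  "feasible V i m A = {x. (\<forall>u\<in>V. \<forall>v\<in>V. x (Inl u, v) = x (Inl v, u)) \<and>
     (\<forall>u\<in>V. \<forall>v\<in>V. u \<noteq> v \<longrightarrow> A u v = 0 \<longrightarrow> x (Inl u, v) = 0) \<and> (\<forall>j<m. x (Inr j, i) = 0)}"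

abbreviation coords :: "'a set \<Rightarrow> nat \<Rightarrow> (('a + nat) \<times> 'a) set" where
  "coords V m \<equiv> (V <+> {..<m}) \<times> V"

lemma tendsto_null_comparison:
  fixes f g :: "nat \<Rightarrow> real"
  assumes "\<And>n. \<bar>f n\<bar> \<le> g n" "g \<longlonglongrightarrow> 0"
  shows "f \<longlonglongrightarrow> 0"
  by (rule tendsto_rabs_zero_cancel, rule tendsto_sandwich[of "\<lambda>_. 0" _ _ g]) (use assms in auto)

lemma abs_divide_le: "0 < b \<Longrightarrow> \<bar>a\<bar> \<le> c * b \<Longrightarrow> \<bar>a / b\<bar> \<le> c" for a b c :: real
  by (simp add: abs_divide pos_divide_le_eq)

lemma tendsto_residual:
  assumes "\<forall>p\<in>coords V m. (\<lambda>n. xs n p) \<longlonglongrightarrow> g p" "j < m" "u \<in> V"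
  shows "(\<lambda>n. residual V i \<epsilon> (xs n) j u) \<longlonglongrightarrow> residual V i \<epsilon> g j u"
  unfolding residual_def using assms by (intro tendsto_intros) auto

lemma tendsto_residual_norm:
  assumes "\<forall>p\<in>coords V m. (\<lambda>n. xs n p) \<longlonglongrightarrow> g p"
  shows "(\<lambda>n. residual_norm V i m \<epsilon> (xs n)) \<longlonglongrightarrow> residual_norm V i m \<epsilon> g"
  unfolding residual_norm_def using tendsto_residual[OF assms] by (intro tendsto_intros) auto

lemma feasible_closed:
  assumes i: "i \<in> V" and xs: "\<forall>n. xs n \<in> feasible V i m A"
    and lim: "\<forall>p\<in>coords V m. (\<lambda>n. xs n p) \<longlonglongrightarrow> g p"
  shows "g \<in> feasible V i m A"
proof -
  have L: "(\<lambda>n. xs n (Inl u, v)) \<longlonglongrightarrow> g (Inl u, v)" if "u \<in> V" "v \<in> V" for u v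
    using that lim by auto
  have "g (Inl u, v) = g (Inl v, u)" if uv: "u \<in> V" "v \<in> V" for u v
  proof (rule LIMSEQ_unique[OF L[OF uv]])
    have "xs n (Inl u, v) = xs n (Inl v, u)" for n using xs[rule_format, of n] uv by (simp add: feasible_def)
    then show "(\<lambda>n. xs n (Inl u, v)) \<longlonglongrightarrow> g (Inl v, u)" using L[OF uv(2,1)] by simp
  qed
  moreover have "g (Inl u, v) = 0" if uv: "u \<in> V" "v \<in> V" "u \<noteq> v" "A u v = 0" for u v
  proof (rule LIMSEQ_unique[OF L[OF uv(1,2)]])
    have "xs n (Inl u, v) = 0" for n using xs[rule_format, of n] uv by (simp add: feasible_def)
    then show "(\<lambda>n. xs n (Inl u, v)) \<longlonglongrightarrow> 0" by simp
  qed
  moreover have "g (Inr j, i) = 0" if j: "j < m" for j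
  proof (rule LIMSEQ_unique)
    show "(\<lambda>n. xs n (Inr j, i)) \<longlonglongrightarrow> g (Inr j, i)" using j i lim by auto
    have "xs n (Inr j, i) = 0" for n using xs[rule_format, of n] j by (simp add: feasible_def)
    then show "(\<lambda>n. xs n (Inr j, i)) \<longlonglongrightarrow> 0" by simp
  qed
  ultimately show ?thesis by (simp add: feasible_def)
qed

section \<open>Stationarity of the residual norm\<close>

text \<open>A direction in which no moved matrix entry meets a moved vector entry causes no
  second-order term, so the squared residual norm along it is a quadratic polynomial in
  \<open>t\<close>.\<close>

lemma residual_add:
  assumes "\<And>u v j. h (Inl u, v) * h (Inr j, v) = 0"
  shows "residual V i \<epsilon> (\<lambda>p. x p + t * h p) j u = residual V i \<epsilon> x j u + t * variation V x h j u"
proof -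
  have "(x (Inl u, v) + t * h (Inl u, v)) * (x (Inr j, v) + t * h (Inr j, v)) =
    x (Inl u, v) * x (Inr j, v) + t * (h (Inl u, v) * x (Inr j, v) + x (Inl u, v) * h (Inr j, v))" for v
    using assms[of u v j] by (auto simp: algebra_simps)
  then have "(\<Sum>v\<in>V. (x (Inl u, v) + t * h (Inl u, v)) * (x (Inr j, v) + t * h (Inr j, v))) =
    (\<Sum>v\<in>V. x (Inl u, v) * x (Inr j, v)) + t * variation V x h j u"
    unfolding variation_def sum_distrib_left sum.distrib[symmetric] by simp
  then show ?thesis by (simp add: residual_def)
qed

text \<open>The target \<epsilon> is \<open>\<kappa>\<^sup>2\<close>, which is also the residual
  norm at \<open>x0\<close>. Ekeland's principle with penalty \<open>\<kappa>\<close> then yields a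
  point within \<open>\<kappa>\<^sup>2 / \<kappa>\<close> of \<open>x0\<close> at which the norm has
  slope at most \<open>\<kappa>\<close>, so distance and slope tend to zero together.\<close>

lemma almost_stationary_point:
  assumes V: "finite V" "i \<in> V" and m: "0 < m" and x0: "x0 \<in> feasible V i m A"
    and R0: "\<And>j u. j < m \<Longrightarrow> u \<in> V \<Longrightarrow> residual V i 0 x0 j u = 0" and \<kappa>: "0 < \<kappa>"
  shows "\<exists>x\<in>feasible V i m A. (\<Sum>p\<in>coords V m. \<bar>x p - x0 p\<bar>) \<le> \<kappa> \<and>
    (\<forall>h\<in>feasible V i m A. (\<forall>u v j. h (Inl u, v) * h (Inr j, v) = 0) \<longrightarrow>
      \<bar>\<Sum>j<m. \<Sum>u\<in>V. residual V i (\<kappa>\<^sup>2) x j u * variation V x h j u\<bar>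
        \<le> \<kappa> * (\<Sum>p\<in>coords V m. \<bar>h p\<bar>) * residual_norm V i m (\<kappa>\<^sup>2) x)"
proof -
  let ?S = "feasible V i m A" and ?\<phi> = "residual_norm V i m (\<kappa>\<^sup>2)"
  let ?R = "residual V i (\<kappa>\<^sup>2)"
  have fin: "finite (coords V m)" using V by simp
  have nonneg: "0 \<le> ?\<phi> x" for x by (simp add: residual_norm_def sum_nonneg)
  obtain x where x: "x \<in> ?S" "?\<phi> x + \<kappa> * (\<Sum>p\<in>coords V m. \<bar>x p - x0 p\<bar>) \<le> ?\<phi> x0"
    "\<forall>y\<in>?S. ?\<phi> x \<le> ?\<phi> y + \<kappa> * (\<Sum>p\<in>coords V m. \<bar>y p - x p\<bar>)"
  proof -
    have "\<exists>x\<in>?S. ?\<phi> x + \<kappa> * (\<Sum>p\<in>coords V m. \<bar>x p - x0 p\<bar>) \<le> ?\<phi> x0 \<and>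
      (\<forall>y\<in>?S. ?\<phi> x \<le> ?\<phi> y + \<kappa> * (\<Sum>p\<in>coords V m. \<bar>y p - x p\<bar>))"
      by (rule ekeland_finite[OF fin nonneg _ _ x0 \<kappa>])
         (erule tendsto_residual_norm, erule (1) feasible_closed[OF V(2)])
    then show ?thesis using that by blast
  qed
  have "?\<phi> x0 = \<kappa>\<^sup>2"
  proof -
    have "?R x0 j u = (if j = 0 then if u = i then - \<kappa>\<^sup>2 else 0 else 0)" if "j < m" "u \<in> V" for j u
      using R0[OF that] by (simp add: residual_def)
    then have "(\<Sum>j<m. \<Sum>u\<in>V. (?R x0 j u)\<^sup>2) = (\<Sum>j<m. if j = 0 then \<Sum>u\<in>V. if u = i then (\<kappa>\<^sup>2)\<^sup>2 else 0 else 0)"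
      by (intro sum.cong refl) (auto intro!: sum.cong)
    also have "\<dots> = (\<kappa>\<^sup>2)\<^sup>2" using m V by simp
    finally show ?thesis unfolding residual_norm_def by (simp only: real_sqrt_abs abs_power2)
  qed
  then have "\<kappa> * (\<Sum>p\<in>coords V m. \<bar>x p - x0 p\<bar>) \<le> \<kappa> * \<kappa>" using x(2) nonneg[of x] by (simp add: power2_eq_square)
  then have dist: "(\<Sum>p\<in>coords V m. \<bar>x p - x0 p\<bar>) \<le> \<kappa>" using \<kappa> by simp
  have "\<bar>\<Sum>j<m. \<Sum>u\<in>V. ?R x j u * variation V x h j u\<bar> \<le> \<kappa> * (\<Sum>p\<in>coords V m. \<bar>h p\<bar>) * ?\<phi> x"
    if h: "h \<in> ?S" "\<forall>u v j. h (Inl u, v) * h (Inr j, v) = 0" for h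
  proof -
    define P where "P = (\<Sum>j<m. \<Sum>u\<in>V. (?R x j u)\<^sup>2)"
    define Q where "Q = (\<Sum>j<m. \<Sum>u\<in>V. ?R x j u * variation V x h j u)"
    define N where "N = (\<Sum>j<m. \<Sum>u\<in>V. (variation V x h j u)\<^sup>2)"
    have P0: "0 \<le> P" by (simp add: P_def sum_nonneg)
    have quad: "(\<Sum>j<m. \<Sum>u\<in>V. (?R (\<lambda>p. x p + t * h p) j u)\<^sup>2) = P + 2 * t * Q + t\<^sup>2 * N" for t
    proof -
      have "(?R (\<lambda>p. x p + t * h p) j u)\<^sup>2 =
        (?R x j u)\<^sup>2 + 2 * t * (?R x j u * variation V x h j u) + t\<^sup>2 * (variation V x h j u)\<^sup>2" for j u
        using residual_add[of h V i "\<kappa>\<^sup>2" x t j u] h(2) by (simp add: power2_sum power_mult_distrib)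
      then have "(\<Sum>u\<in>V. (?R (\<lambda>p. x p + t * h p) j u)\<^sup>2) = (\<Sum>u\<in>V. (?R x j u)\<^sup>2) +
        2 * t * (\<Sum>u\<in>V. ?R x j u * variation V x h j u) + t\<^sup>2 * (\<Sum>u\<in>V. (variation V x h j u)\<^sup>2)" for j
        by (simp only: sum.distrib sum_distrib_left)
      then show ?thesis unfolding P_def Q_def N_def by (simp only: sum.distrib sum_distrib_left)
    qed
    show ?thesis
    \<comment> \<open>The slope argument divides by the norm; where the residual vanishes, both
      sides of the bound are zero.\<close>
    proof (cases "P = 0")
      case True
      have "\<forall>j\<in>{..<m}. (\<Sum>u\<in>V. (?R x j u)\<^sup>2) = 0"
        using True unfolding P_def by (subst (asm) sum_nonneg_eq_0_iff) (auto simp: sum_nonneg)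
      then have "?R x j u = 0" if "j < m" "u \<in> V" for j u
        using that V sum_nonneg_eq_0_iff[OF V(1), of "\<lambda>u. (?R x j u)\<^sup>2"] by auto
      then show ?thesis using True by (simp add: residual_norm_def P_def)
    next
      case False
      have "\<bar>Q\<bar> \<le> (\<kappa> * (\<Sum>p\<in>coords V m. \<bar>h p\<bar>)) * sqrt P"
      proof (rule quadratic_slope_bound)
        show "0 < P" using P0 False by simp
        show "0 \<le> \<kappa> * (\<Sum>p\<in>coords V m. \<bar>h p\<bar>)" using \<kappa> by (simp add: sum_nonneg)
        show "0 \<le> N" by (simp add: N_def sum_nonneg)
        fix t
        show "0 \<le> P + 2 * t * Q + t\<^sup>2 * N" unfolding quad[symmetric] by (simp add: sum_nonneg)
        have "(\<lambda>p. x p + t * h p) \<in> ?S" using x(1) h(1) by (simp add: feasible_def)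
        then have "?\<phi> x \<le> ?\<phi> (\<lambda>p. x p + t * h p) + \<kappa> * (\<Sum>p\<in>coords V m. \<bar>t * h p\<bar>)"
          using x(3) by fastforce
        then show "sqrt P \<le> sqrt (P + 2 * t * Q + t\<^sup>2 * N) + \<kappa> * (\<Sum>p\<in>coords V m. \<bar>h p\<bar>) * \<bar>t\<bar>"
          by (simp add: residual_norm_def quad P_def abs_mult mult_ac flip: sum_distrib_left)
      qed
      then show ?thesis by (simp add: Q_def residual_norm_def P_def)
    qed
  qed
  then show ?thesis using x(1) dist by (intro bexI[of _ x]) auto
qed

text \<open>The inhomogeneous term sits at coordinate \<open>i\<close>, where every vector vanishes,
  so both sides are values of the symmetric bilinear form of the matrix. Its limit is the symmetry
  hypothesis of \<open>stationary_residual_zero\<close>.\<close>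

lemma residual_symmetric:
  assumes V: "finite V" "i \<in> V" and x: "x \<in> feasible V i m A" and jl: "j < m" "l < m"
  shows "(\<Sum>u\<in>V. residual V i \<epsilon> x j u * x (Inr l, u)) = (\<Sum>u\<in>V. residual V i \<epsilon> x l u * x (Inr j, u))"
proof -
  have sym: "symmetric_on V (\<lambda>u v. x (Inl u, v))" using x by (simp add: feasible_def symmetric_on_def)
  have *: "(\<Sum>u\<in>V. residual V i \<epsilon> x j u * x (Inr l, u)) =
    (\<Sum>u\<in>V. x (Inr l, u) * (\<Sum>v\<in>V. x (Inl u, v) * x (Inr j, v)))" if "l < m" for j l
  proof (intro sum.cong refl)
    fix u
    have "x (Inr l, i) = 0" using x that by (simp add: feasible_def)
    then show "residual V i \<epsilon> x j u * x (Inr l, u) = x (Inr l, u) * (\<Sum>v\<in>V. x (Inl u, v) * x (Inr j, v))"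
      by (auto simp: residual_def algebra_simps)
  qed
  show ?thesis unfolding *[OF jl(1)] *[OF jl(2)] by (rule bilinear_symmetric[OF sym])
qed

text \<open>The symmetric change of the entries at \<open>(u, v)\<close> and \<open>(v, u)\<close>;
  for \<open>u = v\<close> the two terms add up to 2, which the identities below allow for.\<close>

fun edge_direction :: "'a \<Rightarrow> 'a \<Rightarrow> ('a + nat) \<times> 'a \<Rightarrow> real" where
  "edge_direction u v (Inl a, b) = (if a = u \<and> b = v then 1 else 0) + (if a = v \<and> b = u then 1 else 0)"
| "edge_direction u v (Inr j, b) = 0"

fun vector_direction :: "nat \<Rightarrow> 'a \<Rightarrow> ('a + nat) \<times> 'a \<Rightarrow> real" where
  "vector_direction j u (Inl a, b) = 0"
| "vector_direction j u (Inr l, b) = (if l = j \<and> b = u then 1 else 0)"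

lemma feasible_edge_direction:
  assumes A: "symmetric_on V A" and uv: "u \<in> V" "v \<in> V" "u = v \<or> A u v \<noteq> 0"
  shows "edge_direction u v \<in> feasible V i m A"
proof -
  have "A u v = A v u" using A uv(1,2) unfolding symmetric_on_def by blast
  then have vu: "u = v \<or> A v u \<noteq> 0" using uv(3) by metis
  have "edge_direction u v (Inl a, b) = 0" if "a \<noteq> b" "A a b = 0" for a b
  proof -
    have "\<not> (a = u \<and> b = v)" using that uv(3) by metis
    moreover have "\<not> (a = v \<and> b = u)" using that vu by metis
    ultimately show ?thesis by (simp only: edge_direction.simps if_False add_0)
  qed
  moreover have "edge_direction u v (Inl a, b) = edge_direction u v (Inl b, a)" for a b
    by (simp only: edge_direction.simps conj_commute add.commute)
  ultimately show ?thesis unfolding feasible_def by (simp del: edge_direction.simps(1))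
qed

lemma feasible_vector_direction: "u \<noteq> i \<Longrightarrow> vector_direction j u \<in> feasible V i m A"
  by (simp add: feasible_def)

text \<open>Summed over \<open>j\<close>, with \<open>c\<close> the residual of vector
  \<open>j\<close>, this is the \<open>(u, v)\<close> entry of the matrix to which the SNIP is
  applied; stationarity in edge directions makes it vanish where the SNIP asks for zeros.\<close>

lemma variation_edge_direction:
  assumes V: "finite V" and uv: "u \<in> V" "v \<in> V"
  shows "(\<Sum>w\<in>V. c w * variation V x (edge_direction u v) j w) = c u * x (Inr j, v) + x (Inr j, u) * c v"
proof -
  have var: "variation V x (edge_direction u v) j w =
    (if w = u then x (Inr j, v) else 0) + (if w = v then x (Inr j, u) else 0)" for w
  proof -
    have "variation V x (edge_direction u v) j w =
      (\<Sum>b\<in>V. (if b = v then if w = u then x (Inr j, v) else 0 else 0) +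
        (if b = u then if w = v then x (Inr j, u) else 0 else 0))"
      unfolding variation_def by (intro sum.cong refl) (simp add: distrib_right)
    then show ?thesis using V uv by (simp add: sum.distrib)
  qed
  have "(\<Sum>w\<in>V. c w * variation V x (edge_direction u v) j w) =
    (\<Sum>w\<in>V. (if w = u then c u * x (Inr j, v) else 0) + (if w = v then x (Inr j, u) * c v else 0))"
    unfolding var by (intro sum.cong refl) (simp add: distrib_left)
  then show ?thesis using V uv by (simp add: sum.distrib)
qed

text \<open>By symmetry of the matrix, stationarity in this direction says that the matrix maps the
  residual of vector \<open>j\<close> to a vector that vanishes at \<open>u\<close>. It is available
  for \<open>u \<noteq> i\<close>, precisely the rows that the SNIP constrains.\<close>

lemma variation_vector_direction:
  assumes V: "finite V" and u: "u \<in> V" and j: "j < m"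
  shows "(\<Sum>l<m. \<Sum>w\<in>V. c (l, w) * variation V x (vector_direction j u) l w) =
    (\<Sum>w\<in>V. c (j, w) * x (Inl w, u))"
proof -
  have var: "variation V x (vector_direction j u) l w = (if l = j then x (Inl w, u) else 0)" for l w
  proof -
    have "variation V x (vector_direction j u) l w =
      (\<Sum>b\<in>V. if b = u then if l = j then x (Inl w, u) else 0 else 0)"
      unfolding variation_def by (intro sum.cong refl) simp
    then show ?thesis using V u by simp
  qed
  have "(\<Sum>l<m. \<Sum>w\<in>V. c (l, w) * variation V x (vector_direction j u) l w) =
    (\<Sum>l<m. if l = j then \<Sum>w\<in>V. c (j, w) * x (Inl w, u) else 0)"
    unfolding var by (intro sum.cong refl) simp
  then show ?thesis using j by simp
qed

text \<open>The Ekeland points of the residual norm converge to the unperturbed point. If their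
  residuals were nonzero infinitely often, the normalized residuals would have a limit point that
  is stationary at the unperturbed point, contradicting \<open>stationary_residual_zero\<close>.\<close>
lemma SNIP_perturb_to_parter:
  assumes V: "finite V" "i \<in> V" and A: "SNIP V i A" and nP: "\<not> parter V i A"
    and pos: "0 < nullity (V - {i}) A"
  shows "\<exists>B. symmetric_on V B \<and> (\<forall>u\<in>V. \<forall>v\<in>V. u \<noteq> v \<longrightarrow> (B u v = 0 \<longleftrightarrow> A u v = 0)) \<and>
    SNIP V i B \<and> parter V i B \<and> nullity (V - {i}) A \<le> nullity (V - {i}) B"
proof -
  define W m where "W = V - {i}" and "m = nullity W A"
  have m: "0 < m" using pos by (simp add: m_def W_def)
  have W: "finite W" "i \<notin> W" using V by (auto simp: W_def)
  have sym: "symmetric_on V A" using A by (simp add: SNIP_def)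
  have sumVW: "sum f V = sum f W" if "f i = 0" for f :: "'a \<Rightarrow> real"
    using sum.remove[OF V, of f] that by (simp add: W_def)
  obtain X0 Y :: "nat \<Rightarrow> 'a \<Rightarrow> real" where X0: "\<And>j. j < m \<Longrightarrow> X0 j \<in> kernel_on W A"
    and Y0: "\<And>j l. j < m \<Longrightarrow> l < m \<Longrightarrow> (\<Sum>v\<in>W. Y j v * X0 l v) = (if j = l then 1 else 0)"
    using dual_family[OF W(1) kernel_supported[of W A]] unfolding m_def nullity_def by blast
  have X0i: "X0 j i = 0" if "j < m" for j using X0[OF that] W by (simp add: kernel_on_def)
  have Y: "(\<Sum>v\<in>V. Y j v * X0 l v) = (if j = l then 1 else 0)" if "j < m" "l < m" for j l
    using Y0[OF that] sumVW[of "\<lambda>v. Y j v * X0 l v"] X0i[OF that(2)] by simp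
  have AX0: "(\<Sum>v\<in>V. A u v * X0 j v) = 0" if "j < m" "u \<in> V" for j u
  proof -
    have "(\<Sum>v\<in>V. A u v * X0 j v) = (\<Sum>v\<in>W. A u v * X0 j v)" by (rule sumVW) (simp add: X0i[OF that(1)])
    also have "\<dots> = 0"
    \<comment> \<open>Row \<open>i\<close> is where \<open>\<not> parter V i A\<close> enters:
      kernel vectors of \<open>A(i)\<close> are annihilated by all of \<open>A\<close>, so the
      residual for \<epsilon> = 0 vanishes at the starting point.\<close>
    proof (cases "u = i")
      case True
      then show ?thesis using nP X0[OF that(1)] by (auto simp: parter_def W_def)
    next
      case False
      then show ?thesis using X0[OF that(1)] that(2) by (simp add: kernel_on_def W_def)
    qed
    finally show ?thesis .
  qed
  define x0 :: "('a + nat) \<times> 'a \<Rightarrow> real" where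
    "x0 p = (case fst p of Inl u \<Rightarrow> A u (snd p) | Inr j \<Rightarrow> X0 j (snd p))" for p
  have x0: "x0 \<in> feasible V i m A" using sym X0i by (simp add: feasible_def x0_def symmetric_on_def)
  have R0: "residual V i 0 x0 j u = 0" if "j < m" "u \<in> V" for j u
    using AX0[OF that] by (simp add: residual_def x0_def)
  define \<kappa> where "\<kappa> n = inverse (real (Suc n))" for n
  have \<kappa>: "0 < \<kappa> n" for n by (simp add: \<kappa>_def)
  have \<kappa>0: "\<kappa> \<longlonglongrightarrow> 0" unfolding \<kappa>_def by (rule LIMSEQ_inverse_real_of_nat)
  let ?R = "\<lambda>n. residual V i ((\<kappa> n)\<^sup>2)" and ?S = "feasible V i m A" and ?I = "coords V m"
  have "\<forall>n. \<exists>x. x \<in> ?S \<and> (\<Sum>p\<in>?I. \<bar>x p - x0 p\<bar>) \<le> \<kappa> n \<and>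
    (\<forall>h\<in>?S. (\<forall>u v j. h (Inl u, v) * h (Inr j, v) = 0) \<longrightarrow>
      \<bar>\<Sum>j<m. \<Sum>u\<in>V. ?R n x j u * variation V x h j u\<bar>
        \<le> \<kappa> n * (\<Sum>p\<in>?I. \<bar>h p\<bar>) * residual_norm V i m ((\<kappa> n)\<^sup>2) x)"
    using almost_stationary_point[OF V m x0 R0 \<kappa>] by blast
  from choice[OF this] obtain xs where xs0: "\<forall>n. xs n \<in> ?S \<and> (\<Sum>p\<in>?I. \<bar>xs n p - x0 p\<bar>) \<le> \<kappa> n \<and>
    (\<forall>h\<in>?S. (\<forall>u v j. h (Inl u, v) * h (Inr j, v) = 0) \<longrightarrow>
      \<bar>\<Sum>j<m. \<Sum>u\<in>V. ?R n (xs n) j u * variation V (xs n) h j u\<bar>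
        \<le> \<kappa> n * (\<Sum>p\<in>?I. \<bar>h p\<bar>) * residual_norm V i m ((\<kappa> n)\<^sup>2) (xs n))" ..
  have xsS: "xs n \<in> ?S" and dist: "(\<Sum>p\<in>?I. \<bar>xs n p - x0 p\<bar>) \<le> \<kappa> n" for n using xs0 by auto
  define \<phi> where "\<phi> n = residual_norm V i m ((\<kappa> n)\<^sup>2) (xs n)" for n
  have stat: "\<bar>\<Sum>j<m. \<Sum>u\<in>V. ?R n (xs n) j u * variation V (xs n) h j u\<bar> \<le> \<kappa> n * (\<Sum>p\<in>?I. \<bar>h p\<bar>) * \<phi> n"
    if "h \<in> ?S" "\<forall>u v j. h (Inl u, v) * h (Inr j, v) = 0" for n h
    using xs0 that unfolding \<phi>_def by blast
  have finI: "finite ?I" using V by simp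
  have conv: "(\<lambda>n. xs n p) \<longlonglongrightarrow> x0 p" if p: "p \<in> ?I" for p
  proof -
    have "\<bar>xs n p - x0 p\<bar> \<le> \<kappa> n" for n
      using member_le_sum[OF p _ finI, of "\<lambda>p. \<bar>xs n p - x0 p\<bar>"] dist[of n] by simp
    then have "(\<lambda>n. xs n p - x0 p) \<longlonglongrightarrow> 0" by (rule tendsto_null_comparison[OF _ \<kappa>0])
    then show ?thesis by (rule LIM_zero_cancel)
  qed
  have convA: "(\<lambda>n. xs n (Inl u, v)) \<longlonglongrightarrow> A u v" if "u \<in> V" "v \<in> V" for u v
    using conv[of "(Inl u, v)"] that by (auto simp: x0_def)
  have convX: "(\<lambda>n. xs n (Inr j, v)) \<longlonglongrightarrow> X0 j v" if "j < m" "v \<in> V" for j v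
    using conv[of "(Inr j, v)"] that by (auto simp: x0_def)
  have \<phi>0: "0 \<le> \<phi> n" for n by (simp add: \<phi>_def residual_norm_def sum_nonneg)
  have \<phi>sq: "(\<phi> n)\<^sup>2 = (\<Sum>j<m. \<Sum>u\<in>V. (?R n (xs n) j u)\<^sup>2)" for n
    by (simp add: \<phi>_def residual_norm_def sum_nonneg)
  have R_le: "\<bar>?R n (xs n) j u\<bar> \<le> \<phi> n" if "j < m" "u \<in> V" for n j u
  proof (rule power2_le_imp_le[OF _ \<phi>0])
    have "(?R n (xs n) j u)\<^sup>2 \<le> (\<Sum>u\<in>V. (?R n (xs n) j u)\<^sup>2)"
      using member_le_sum[OF that(2) _ V(1), of "\<lambda>u. (?R n (xs n) j u)\<^sup>2"] by simp
    also have "\<dots> \<le> (\<Sum>j<m. \<Sum>u\<in>V. (?R n (xs n) j u)\<^sup>2)"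
      using member_le_sum[of j "{..<m}" "\<lambda>j. \<Sum>u\<in>V. (?R n (xs n) j u)\<^sup>2"] that(1) by (simp add: sum_nonneg)
    finally show "\<bar>?R n (xs n) j u\<bar>\<^sup>2 \<le> (\<phi> n)\<^sup>2" by (simp add: \<phi>sq)
  qed
  have ev1: "\<forall>\<^sub>F n in sequentially. \<phi> n = 0"
  proof (rule ccontr)
    assume "\<not> ?thesis"
    then obtain r :: "nat \<Rightarrow> nat" where r: "strict_mono r" "\<forall>n. \<phi> (r n) \<noteq> 0"
      using not_eventually_sequentiallyD by blast
    have \<phi>r: "0 < \<phi> (r n)" for n using r(2) \<phi>0[of "r n"] by (simp add: less_le)
    define Q where "Q n p = ?R (r n) (xs (r n)) (fst p) (snd p) / \<phi> (r n)" for n p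
    have fin: "finite ({..<m} \<times> V)" using V by simp
    have "\<forall>n. \<forall>p\<in>{..<m} \<times> V. \<bar>Q n p\<bar> \<le> 1"
    proof (intro allI ballI)
      fix n p assume "p \<in> {..<m} \<times> V"
      then have "\<bar>?R (r n) (xs (r n)) (fst p) (snd p)\<bar> \<le> 1 * \<phi> (r n)" using R_le by auto
      then show "\<bar>Q n p\<bar> \<le> 1" unfolding Q_def by (rule abs_divide_le[OF \<phi>r])
    qed
    from bounded_family_convergent_subseq[OF fin this]
    obtain q L where q: "strict_mono q" "\<forall>p\<in>{..<m} \<times> V. (\<lambda>n. Q (q n) p) \<longlonglongrightarrow> L p" by blast
    define s where "s n = r (q n)" for n
    have s: "strict_mono s" using r(1) q(1) by (simp add: strict_mono_def s_def)
    have \<phi>s: "0 < \<phi> (s n)" for n using \<phi>r by (simp add: s_def)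
    have limQ: "(\<lambda>n. ?R (s n) (xs (s n)) j u / \<phi> (s n)) \<longlonglongrightarrow> L (j, u)" if "j < m" "u \<in> V" for j u
      using q(2) that by (auto simp: Q_def s_def)
    have limA: "(\<lambda>n. xs (s n) (Inl u, v)) \<longlonglongrightarrow> A u v" if "u \<in> V" "v \<in> V" for u v
      using LIMSEQ_subseq_LIMSEQ[OF convA[OF that] s] by (simp add: o_def)
    have limX: "(\<lambda>n. xs (s n) (Inr j, v)) \<longlonglongrightarrow> X0 j v" if "j < m" "v \<in> V" for j v
      using LIMSEQ_subseq_LIMSEQ[OF convX[OF that] s] by (simp add: o_def)
    have lim\<kappa>: "(\<lambda>n. \<kappa> (s n)) \<longlonglongrightarrow> 0"
      using LIMSEQ_subseq_LIMSEQ[OF \<kappa>0 s] by (simp add: o_def)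
    have lim_var: "(\<lambda>n. variation V (xs (s n)) h j u) \<longlonglongrightarrow> variation V x0 h j u" if "j < m" "u \<in> V" for h j u
      unfolding variation_def x0_def using that limA limX by (auto intro!: tendsto_intros)
    have stat0: "(\<Sum>j<m. \<Sum>u\<in>V. L (j, u) * variation V x0 h j u) = 0"
      if h: "h \<in> ?S" "\<forall>u v j. h (Inl u, v) * h (Inr j, v) = 0" for h
    proof (rule LIMSEQ_unique)
      let ?T = "\<lambda>n. \<Sum>j<m. \<Sum>u\<in>V. ?R (s n) (xs (s n)) j u / \<phi> (s n) * variation V (xs (s n)) h j u"
      show "?T \<longlonglongrightarrow> (\<Sum>j<m. \<Sum>u\<in>V. L (j, u) * variation V x0 h j u)"
        by (intro tendsto_sum tendsto_mult limQ lim_var) auto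
      have "\<bar>?T n\<bar> \<le> \<kappa> (s n) * (\<Sum>p\<in>?I. \<bar>h p\<bar>)" for n
      proof -
        have "?T n = (\<Sum>j<m. \<Sum>u\<in>V. ?R (s n) (xs (s n)) j u * variation V (xs (s n)) h j u) / \<phi> (s n)"
          by (simp add: sum_divide_distrib)
        then show ?thesis using stat[OF h, of "s n"] \<phi>s[of n] by (simp only:) (rule abs_divide_le)
      qed
      moreover have "(\<lambda>n. \<kappa> (s n) * (\<Sum>p\<in>?I. \<bar>h p\<bar>)) \<longlonglongrightarrow> 0"
        using tendsto_mult_left_zero[OF lim\<kappa>] by simp
      ultimately show "?T \<longlonglongrightarrow> 0"
        by (rule tendsto_null_comparison)
    qed
    have "L (j, u) = 0" if ju: "j < m" "u \<in> V" for j u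
    proof (rule stationary_residual_zero[OF V A AX0 Y _ _ _ ju, where R = "\<lambda>j u. L (j, u)"])
      fix u v assume uv: "u \<in> V" "v \<in> V" "u = v \<or> A u v \<noteq> 0"
      show "(\<Sum>j<m. L (j, u) * X0 j v + X0 j u * L (j, v)) = 0"
        using stat0[OF feasible_edge_direction[OF sym uv]] variation_edge_direction[OF V(1) uv(1,2), of "\<lambda>w. L (_, w)" x0]
        by (simp add: x0_def)
    next
      fix j u assume ju: "j < m" "u \<in> V - {i}"
      have "(\<Sum>l<m. \<Sum>w\<in>V. L (l, w) * variation V x0 (vector_direction j u) l w) = (\<Sum>w\<in>V. L (j, w) * A w u)"
        using variation_vector_direction[OF V(1) _ ju(1), of u L x0] ju by (simp add: x0_def)
      then have "(\<Sum>w\<in>V. L (j, w) * A w u) = 0"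
        using stat0[OF feasible_vector_direction[of u i]] ju by simp
      moreover have "(\<Sum>v\<in>V. A u v * L (j, v)) = (\<Sum>w\<in>V. L (j, w) * A w u)"
      proof (intro sum.cong refl)
        fix v assume "v \<in> V"
        then have "A u v = A v u" using sym ju(2) unfolding symmetric_on_def by blast
        then show "A u v * L (j, v) = L (j, v) * A v u" by simp
      qed
      ultimately show "(\<Sum>v\<in>V. A u v * L (j, v)) = 0" by simp
    next
      fix j l assume jl: "j < m" "l < m"
      have lim: "(\<lambda>n. \<Sum>u\<in>V. ?R (s n) (xs (s n)) j u / \<phi> (s n) * xs (s n) (Inr l, u)) \<longlonglongrightarrow> (\<Sum>u\<in>V. L (j, u) * X0 l u)"
        if "j < m" "l < m" for j l
        by (intro tendsto_sum tendsto_mult limQ limX that)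
      have "(\<Sum>u\<in>V. ?R (s n) (xs (s n)) j u / \<phi> (s n) * xs (s n) (Inr l, u)) =
        (\<Sum>u\<in>V. ?R (s n) (xs (s n)) l u / \<phi> (s n) * xs (s n) (Inr j, u))" for n
        using residual_symmetric[OF V xsS jl, of "(\<kappa> (s n))\<^sup>2" "s n"]
        by (simp flip: sum_divide_distrib)
      then show "(\<Sum>u\<in>V. L (j, u) * X0 l u) = (\<Sum>u\<in>V. L (l, u) * X0 j u)"
        using lim[OF jl] lim[OF jl(2,1)] by (simp add: LIMSEQ_unique)
    qed
    then have "(\<Sum>j<m. \<Sum>u\<in>V. (L (j, u))\<^sup>2) = 0" by simp
    moreover have "(\<Sum>j<m. \<Sum>u\<in>V. (L (j, u))\<^sup>2) = 1"
    proof (rule LIMSEQ_unique)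
      let ?T = "\<lambda>n. \<Sum>j<m. \<Sum>u\<in>V. (?R (s n) (xs (s n)) j u / \<phi> (s n))\<^sup>2"
      show "?T \<longlonglongrightarrow> (\<Sum>j<m. \<Sum>u\<in>V. (L (j, u))\<^sup>2)" by (intro tendsto_sum tendsto_power limQ) auto
      have "?T n = (\<phi> (s n))\<^sup>2 / (\<phi> (s n))\<^sup>2" for n
        unfolding \<phi>sq[of "s n"] power_divide sum_divide_distrib ..
      then have "?T n = 1" for n using \<phi>s[of n] by simp
      then show "?T \<longlonglongrightarrow> 1" by simp
    qed
    ultimately show False by simp
  qed
  define B where "B n = (\<lambda>u v. xs n (Inl u, v))" for n
  have symB: "symmetric_on V (B n)" for n using xsS[of n] by (simp add: B_def feasible_def symmetric_on_def)
  have convB: "(\<lambda>n. B n u v) \<longlonglongrightarrow> A u v" if "u \<in> V" "v \<in> V" for u v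
    using convA[OF that] by (simp add: B_def)
  have ev2: "\<forall>\<^sub>F n in sequentially. SNIP V i (B n)" by (rule eventually_SNIP[OF V(1) A symB convB])
  have ev3: "\<forall>\<^sub>F n in sequentially. \<forall>u\<in>V. \<forall>v\<in>V. A u v \<noteq> 0 \<longrightarrow> B n u v \<noteq> 0"
  proof (intro eventually_ball_finite ballI V)
    fix u v assume "u \<in> V" "v \<in> V"
    then show "\<forall>\<^sub>F n in sequentially. A u v \<noteq> 0 \<longrightarrow> B n u v \<noteq> 0"
      using tendsto_imp_eventually_ne[OF convB, of u v 0] by (cases "A u v = 0") (auto elim: eventually_mono)
  qed
  \<comment> \<open>The pairing matrix of the fixed dual family with the perturbed vectors tends to
    the identity, hence is diagonally dominant for large \<open>n\<close>. This keeps the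
    \<open>m\<close> vectors independent.\<close>
  define D where "D n = (\<lambda>j l. \<Sum>v\<in>V. Y j v * xs n (Inr l, v))" for n
  have ev4: "\<forall>\<^sub>F n in sequentially. \<forall>j\<in>{..<m}. 0 < \<bar>D n j j\<bar> - (\<Sum>l\<in>{..<m} - {j}. \<bar>D n j l\<bar>)"
  proof (intro eventually_ball_finite ballI)
    fix j assume j: "j \<in> {..<m}"
    have D: "(\<lambda>n. D n j l) \<longlonglongrightarrow> (if j = l then 1 else 0)" if "l < m" for l
    proof -
      have "(\<lambda>n. D n j l) \<longlonglongrightarrow> (\<Sum>v\<in>V. Y j v * X0 l v)"
        unfolding D_def using that by (intro tendsto_sum tendsto_mult tendsto_const convX)
      then show ?thesis using Y[of j l] j that by simp
    qed
    have "(\<lambda>n. \<bar>D n j j\<bar> - (\<Sum>l\<in>{..<m} - {j}. \<bar>D n j l\<bar>)) \<longlonglongrightarrow>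
      \<bar>if j = j then 1 else 0\<bar> - (\<Sum>l\<in>{..<m} - {j}. \<bar>if j = l then 1 else 0\<bar>)"
      using j by (intro tendsto_diff tendsto_rabs tendsto_sum D) auto
    then have "(\<lambda>n. \<bar>D n j j\<bar> - (\<Sum>l\<in>{..<m} - {j}. \<bar>D n j l\<bar>)) \<longlonglongrightarrow> 1" by (simp add: sum.neutral)
    then show "\<forall>\<^sub>F n in sequentially. 0 < \<bar>D n j j\<bar> - (\<Sum>l\<in>{..<m} - {j}. \<bar>D n j l\<bar>)"
      by (rule order_tendstoD) simp
  qed simp
  from eventually_conj[OF ev1 eventually_conj[OF ev2 eventually_conj[OF ev3 ev4]]]
  obtain n where n: "\<phi> n = 0" "SNIP V i (B n)" "\<forall>u\<in>V. \<forall>v\<in>V. A u v \<noteq> 0 \<longrightarrow> B n u v \<noteq> 0"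
    "\<forall>j\<in>{..<m}. 0 < \<bar>D n j j\<bar> - (\<Sum>l\<in>{..<m} - {j}. \<bar>D n j l\<bar>)"
    using eventually_happens'[OF sequentially_bot] by blast
  have R: "?R n (xs n) j u = 0" if "j < m" "u \<in> V" for j u using R_le[OF that, of n] n(1) by simp
  have xi: "xs n (Inr j, i) = 0" if "j < m" for j using xsS[of n] that by (simp add: feasible_def)
  define X where "X j = (\<lambda>v. if v \<in> W then xs n (Inr j, v) else 0)" for j
  \<comment> \<open>Since \<open>\<phi> n = 0\<close>, the system is solved exactly: rows other than
    \<open>i\<close> give \<open>m\<close> kernel vectors of \<open>B(i)\<close>, and row
    \<open>i\<close> takes the nonzero value \<open>(\<kappa> n)\<^sup>2\<close> on the vector with
    index 0.\<close>
  have row: "(\<Sum>v\<in>W. B n u v * X j v) = (if j = 0 \<and> u = i then (\<kappa> n)\<^sup>2 else 0)" if "j < m" "u \<in> V" for j u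
  proof -
    have "(\<Sum>v\<in>W. B n u v * X j v) = (\<Sum>v\<in>V. xs n (Inl u, v) * xs n (Inr j, v))"
      using sumVW[of "\<lambda>v. xs n (Inl u, v) * xs n (Inr j, v)"] xi[OF that(1)] by (simp add: B_def X_def)
    then show ?thesis using R[OF that] by (simp add: residual_def)
  qed
  have X: "X j \<in> kernel_on W (B n)" if "j < m" for j
    using row[OF that] W by (auto simp: kernel_on_def X_def W_def)
  have "parter V i (B n)"
    using X[OF m] row[OF m V(2)] \<kappa>[of n] by (auto simp: parter_def W_def intro!: bexI[of _ "X 0"])
  moreover have "m \<le> nullity W (B n)" unfolding nullity_def
  proof (rule independent_family_le_dim[OF W(1) kernel_supported X])
    fix c :: "nat \<Rightarrow> real" and j
    assume c: "\<And>v. (\<Sum>l<m. c l * X l v) = 0" and j: "j < m"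
    have c': "(\<Sum>l<m. c l * xs n (Inr l, v)) = 0" if "v \<in> V" for v
    proof (cases "v = i")
      case True
      then show ?thesis using xi by simp
    next
      case False
      then show ?thesis using c[of v] that by (simp add: X_def W_def)
    qed
    \<comment> \<open>Coefficients from index \<open>m\<close> on are cut off, as members of
      \<open>kernel_on {..<m}\<close> must vanish there.\<close>
    let ?c = "\<lambda>l. if l < m then c l else 0"
    have "(\<Sum>l<m. D n p l * ?c l) = 0" if "p < m" for p
    proof -
      have "(\<Sum>l<m. D n p l * ?c l) = (\<Sum>l<m. \<Sum>v\<in>V. Y p v * (c l * xs n (Inr l, v)))"
        by (simp add: D_def sum_distrib_right sum_distrib_left mult_ac)
      also have "\<dots> = (\<Sum>v\<in>V. \<Sum>l<m. Y p v * (c l * xs n (Inr l, v)))" by (rule sum.swap)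
      also have "\<dots> = 0" using c' by (simp flip: sum_distrib_left)
      finally show ?thesis .
    qed
    then have "?c \<in> kernel_on {..<m} (D n)" by (auto simp: kernel_on_def)
    moreover have "kernel_on {..<m} (D n) = {0}"
      using n(4) by (intro kernel_diagonally_dominant) auto
    ultimately have "?c = 0" by blast
    then show "c j = 0" using j by (auto simp: fun_eq_iff split: if_splits)
  qed
  moreover have "B n u v = 0 \<longleftrightarrow> A u v = 0" if "u \<in> V" "v \<in> V" "u \<noteq> v" for u v
    using xsS[of n] n(3) that by (auto simp: B_def feasible_def)
  ultimately show ?thesis using symB n(2) by (intro exI[of _ "B n"]) (auto simp: m_def W_def)
qed

lemma allows_equal_imp_parter_pair:
  assumes G: "rooted_graph G" and a: "allows_with_SNIP G (Suc m) (Suc m)"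
  shows "\<exists>l\<ge>m. allows_with_SNIP G l (Suc l)"
proof -
  define V i where "V = verts G" and "i = root G"
  have V: "finite V" "i \<in> V" using G by (auto simp: rooted_graph_def V_def i_def)
  obtain A where A: "A \<in> sym_matrices G" "SNIP V i A" "nullity V A = Suc m" "nullity (V - {i}) A = Suc m"
    using a by (auto simp: allows_with_SNIP_def V_def i_def)
  have sym: "symmetric_on V A" using A by (simp add: SNIP_def)
  have nP: "\<not> parter V i A" using nullity_pair_parter[OF V sym] A by (auto split: if_splits)
  obtain B where B: "symmetric_on V B" "\<forall>u\<in>V. \<forall>v\<in>V. u \<noteq> v \<longrightarrow> (B u v = 0 \<longleftrightarrow> A u v = 0)"
    "SNIP V i B" "parter V i B" "Suc m \<le> nullity (V - {i}) B"
    using SNIP_perturb_to_parter[OF V A(2) nP] A(4) by auto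
  have "nullity (V - {i}) B = Suc (nullity V B)" using nullity_parter[OF V B(1,4)] .
  moreover have "B \<in> sym_matrices G" using A(1) B(1,2) by (auto simp: sym_matrices_def V_def)
  ultimately have "allows_with_SNIP G (nullity V B) (Suc (nullity V B))"
    using B(3) unfolding allows_with_SNIP_def by (intro bexI[of _ B]) (auto simp: V_def i_def)
  moreover have "m \<le> nullity V B" using B(5) \<open>nullity (V - {i}) B = Suc (nullity V B)\<close> by simp
  ultimately show ?thesis by blast
qed

section \<open>Rooted minors\<close>

text \<open>Properness of a minor is a negative condition, the absence of an isomorphism. A strict
  drop in this isomorphism invariant certifies it, and every minor step causes one.\<close>

definition graph_size :: "'a rooted_graph \<Rightarrow> nat" where
  "graph_size G = card (verts G) + card (edges G)"

lemma rooted_graph_eta [simp]: "\<lparr>verts = verts G, edges = edges G, root = root G\<rparr> = G"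
  by (cases G) simp

lemma finite_edges: "rooted_graph G \<Longrightarrow> finite (edges G)"
  by (rule finite_subset[of _ "Pow (verts G)"]) (auto simp: rooted_graph_def)

lemma edge_verts: "rooted_graph G \<Longrightarrow> {u, v} \<in> edges G \<Longrightarrow> u \<in> verts G \<and> v \<in> verts G \<and> u \<noteq> v"
  by (fastforce simp: rooted_graph_def)

lemma edge_doubleton:
  assumes "rooted_graph G" "e \<in> edges G" "x \<in> e"
  obtains y where "e = {x, y}" "x \<noteq> y"
proof -
  have "card e = 2" using assms by (simp add: rooted_graph_def)
  then obtain a b where "e = {a, b}" "a \<noteq> b" by (auto simp: card_2_iff)
  then show ?thesis using that[of a] that[of b] assms(3) by auto
qed

lemma contract_map_id: "v \<notin> e \<Longrightarrow> contract_map u v ` e = e"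
  by (auto simp: contract_map_def image_def)

lemma rooted_graph_reroot:
  "rooted_graph G \<Longrightarrow> {root G, d} \<in> edges G \<Longrightarrow> rooted_graph (reroot G d)"
  using edge_verts[of G "root G" d] by (auto simp: rooted_graph_def reroot_def)

lemma rooted_graph_root_extension: "rooted_graph H \<Longrightarrow> i \<notin> verts H \<Longrightarrow> rooted_graph (root_extension i H)"
  by (auto simp: rooted_graph_def root_extension_def card_insert_if)

lemma graph_size_root_extension:
  assumes "rooted_graph H" "i \<notin> verts H"
  shows "graph_size (root_extension i H) = graph_size H + 2"
proof -
  have "{i, root H} \<notin> edges H" using assms by (auto simp: rooted_graph_def)
  then show ?thesis using assms finite_edges[of H] by (simp add: graph_size_def root_extension_def rooted_graph_def)
qed

lemma rooted_graph_step:
  assumes "minor_step G F" "rooted_graph G"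
  shows "rooted_graph F"
  using assms
proof cases
  case (contract_edge u v)
  have uv: "u \<in> verts G" "v \<in> verts G" using edge_verts[OF assms(2) contract_edge(2)] by auto
  have "contract_map u v ` e \<subseteq> verts G - {v} \<and> card (contract_map u v ` e) = 2"
    if e: "e \<in> edges G" "e \<noteq> {u, v}" for e
  proof
    have sub: "e \<subseteq> verts G" and c: "card e = 2" using assms(2) e by (auto simp: rooted_graph_def)
    show "contract_map u v ` e \<subseteq> verts G - {v}"
      using sub uv contract_edge(3) by (auto simp: contract_map_def)
    show "card (contract_map u v ` e) = 2"
    proof (cases "v \<in> e")
      case True
      then obtain y where y: "e = {v, y}" "v \<noteq> y" using edge_doubleton[OF assms(2) e(1)] by blast
      then have "y \<noteq> u" using e(2) by auto
      then show ?thesis using y by (auto simp: contract_map_def)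
    qed (use c in \<open>simp add: contract_map_id\<close>)
  qed
  then show ?thesis using assms(2) uv contract_edge
    by (auto simp: rooted_graph_def contract_map_def)
qed (auto simp: rooted_graph_def)

lemma rooted_graph_steps: "minor_step\<^sup>*\<^sup>* G F \<Longrightarrow> rooted_graph G \<Longrightarrow> rooted_graph F"
  by (induction rule: rtranclp_induct) (auto intro: rooted_graph_step)

lemma graph_size_step:
  assumes "minor_step G F" "rooted_graph G"
  shows "graph_size F < graph_size G"
  using assms(1)
proof cases
  case (delete_edge e)
  then show ?thesis using finite_edges[OF assms(2)] card_Diff1_less[of "edges G" e] by (simp add: graph_size_def)
next
  case (delete_vertex v)
  have "card (verts G - {v}) < card (verts G)"
    using assms(2) delete_vertex card_Diff1_less[of "verts G" v] by (simp add: rooted_graph_def)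
  moreover have "card {e \<in> edges G. v \<notin> e} \<le> card (edges G)"
    by (rule card_mono[OF finite_edges[OF assms(2)]]) auto
  ultimately show ?thesis using delete_vertex by (simp add: graph_size_def)
next
  case (contract_edge u v)
  have "v \<in> verts G" using edge_verts[OF assms(2) contract_edge(2)] by auto
  then have "card (verts G - {v}) < card (verts G)"
    using assms(2) card_Diff1_less[of "verts G" v] by (simp add: rooted_graph_def)
  moreover have "{contract_map u v ` e | e. e \<in> edges G \<and> e \<noteq> {u, v}} \<subseteq> (\<lambda>e. contract_map u v ` e) ` edges G" by auto
  then have "card {contract_map u v ` e | e. e \<in> edges G \<and> e \<noteq> {u, v}} \<le> card (edges G)"
    using finite_edges[OF assms(2)] by (meson card_image_le card_mono finite_imageI le_trans)
  ultimately show ?thesis using contract_edge by (simp add: graph_size_def)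
qed

lemma graph_size_steps:
  assumes "minor_step\<^sup>*\<^sup>* G F" "rooted_graph G"
  shows "F = G \<or> graph_size F < graph_size G"
  using assms
proof (induction rule: rtranclp_induct)
  case (step F F')
  then show ?case using graph_size_step[of F F'] rooted_graph_steps[of G F] by auto
qed simp

text \<open>Contraction reuses the name of one end, so a vertex that is new for \<open>G\<close>
  stays new for \<open>F\<close>.\<close>

lemma verts_steps: "minor_step\<^sup>*\<^sup>* G F \<Longrightarrow> verts F \<subseteq> verts G"
  by (induction rule: rtranclp_induct) (auto elim!: minor_step.cases)

lemma rooted_iso_refl: "rooted_iso G G"
  unfolding rooted_iso_def by (rule exI[of _ id]) simp

lemma rooted_iso_sym:
  assumes "rooted_iso G H" "rooted_graph G"
  shows "rooted_iso H G"
proof -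
  obtain f where f: "bij_betw f (verts G) (verts H)" "edges H = (\<lambda>e. f ` e) ` edges G" "f (root G) = root H"
    using assms(1) by (auto simp: rooted_iso_def)
  let ?g = "inv_into (verts G) f"
  have inj: "inj_on f (verts G)" using f(1) by (simp add: bij_betw_def)
  have "?g ` f ` e = e" if "e \<in> edges G" for e
    using assms(2) that by (intro inv_into_image_cancel[OF inj]) (auto simp: rooted_graph_def)
  then have "edges G = (\<lambda>e. ?g ` e) ` edges H" unfolding f(2) image_image by simp
  moreover have "?g (root H) = root G"
    using assms(2) inv_into_f_f[OF inj, of "root G"] f(3) by (simp add: rooted_graph_def)
  ultimately show ?thesis unfolding rooted_iso_def using bij_betw_inv_into[OF f(1)] by blast
qed

lemma rooted_iso_imp:
  assumes iso: "rooted_iso G H" and G: "rooted_graph G"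
  shows "rooted_graph H" "graph_size H = graph_size G" "card (verts H) = card (verts G)"
proof -
  obtain f where f: "bij_betw f (verts G) (verts H)" "edges H = (\<lambda>e. f ` e) ` edges G" "f (root G) = root H"
    using iso by (auto simp: rooted_iso_def)
  have inj: "inj_on f (verts G)" and img: "f ` verts G = verts H" using f(1) by (auto simp: bij_betw_def)
  have "card (f ` e) = 2" "f ` e \<subseteq> verts H" if "e \<in> edges G" for e
  proof -
    have e: "e \<subseteq> verts G" "card e = 2" using G that by (auto simp: rooted_graph_def)
    then show "card (f ` e) = 2" using card_image[OF inj_on_subset[OF inj e(1)]] by simp
    show "f ` e \<subseteq> verts H" using e(1) img by auto
  qed
  moreover have "finite (f ` verts G)" "f (root G) \<in> f ` verts G" using G by (auto simp: rooted_graph_def)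
  then have "finite (verts H)" "root H \<in> verts H" using f(3) img by simp_all
  ultimately show "rooted_graph H" using f(2) by (auto simp: rooted_graph_def)
  show cv: "card (verts H) = card (verts G)" using bij_betw_same_card[OF f(1)] by simp
  have "inj_on (\<lambda>e. f ` e) (edges G)"
  proof (rule inj_on_subset[OF inj_on_image_Pow[OF inj]])
    show "edges G \<subseteq> Pow (verts G)" using G by (auto simp: rooted_graph_def)
  qed
  then have "card (edges H) = card (edges G)" unfolding f(2) by (rule card_image)
  then show "graph_size H = graph_size G" using cv by (simp add: graph_size_def)
qed

section \<open>Root extension and rerooting as minor operations\<close>

lemma delete_edges_steps:
  assumes "finite D" "D \<subseteq> edges G"
  shows "minor_step\<^sup>*\<^sup>* G \<lparr>verts = verts G, edges = edges G - D, root = root G\<rparr>"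
  using assms
proof (induction D rule: finite_induct)
  case (insert e D)
  let ?F = "\<lparr>verts = verts G, edges = edges G - D, root = root G\<rparr>"
  have "minor_step ?F \<lparr>verts = verts ?F, edges = edges ?F - {e}, root = root ?F\<rparr>"
    using insert by (intro minor_step.delete_edge) auto
  moreover have "edges ?F - {e} = edges G - insert e D" by auto
  moreover have "minor_step\<^sup>*\<^sup>* G ?F" using insert by auto
  ultimately show ?case by auto
qed simp

lemma steps_root_extension_reroot:
  assumes G: "rooted_graph G" and d: "{root G, d} \<in> edges G"
  shows "minor_step\<^sup>*\<^sup>* G (root_extension (root G) (reroot G d))"
proof -
  define D where "D = {e \<in> edges G. root G \<in> e} - {{root G, d}}"
  have "minor_step\<^sup>*\<^sup>* G \<lparr>verts = verts G, edges = edges G - D, root = root G\<rparr>"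
    using finite_edges[OF G] by (intro delete_edges_steps) (auto simp: D_def)
  moreover have "edges G - D = insert {root G, d} {e \<in> edges G. root G \<notin> e}" using d by (auto simp: D_def)
  moreover have "insert (root G) (verts G - {root G}) = verts G" using G by (auto simp: rooted_graph_def)
  ultimately show ?thesis by (simp add: root_extension_def reroot_def)
qed

lemma step_contract_root_extension:
  assumes H: "rooted_graph H" and i: "i \<notin> verts H"
  shows "minor_step (root_extension i H) H"
proof -
  have ne: "root H \<noteq> i" using H i by (auto simp: rooted_graph_def)
  have E: "i \<notin> e" if "e \<in> edges H" for e using H i that by (auto simp: rooted_graph_def)
  have "minor_step (root_extension i H) \<lparr>verts = verts (root_extension i H) - {i},
    edges = {contract_map (root H) i ` e | e. e \<in> edges (root_extension i H) \<and> e \<noteq> {root H, i}},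
    root = contract_map (root H) i (root (root_extension i H))\<rparr>"
    using ne by (intro minor_step.contract_edge) (auto simp: root_extension_def insert_commute)
  moreover have "{contract_map (root H) i ` e | e. e \<in> edges (root_extension i H) \<and> e \<noteq> {root H, i}} = edges H"
  proof -
    have "{contract_map (root H) i ` e | e. e \<in> edges (root_extension i H) \<and> e \<noteq> {root H, i}}
      = {contract_map (root H) i ` e | e. e \<in> edges H}"
      using E by (auto simp: root_extension_def insert_commute)
    also have "\<dots> = {e | e. e \<in> edges H}" using E by (metis (no_types, lifting) contract_map_id)
    finally show ?thesis by simp
  qed
  moreover have "verts (root_extension i H) - {i} = verts H" using i by (auto simp: root_extension_def)
  moreover have "contract_map (root H) i (root (root_extension i H)) = root H" by (simp add: root_extension_def contract_map_def)
  ultimately show ?thesis by simp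
qed

lemma steps_reroot:
  assumes G: "rooted_graph G" and d: "{root G, d} \<in> edges G"
  shows "minor_step\<^sup>*\<^sup>* G (reroot G d)"
proof -
  have "minor_step (root_extension (root G) (reroot G d)) (reroot G d)"
    using rooted_graph_reroot[OF G d] by (rule step_contract_root_extension) (simp add: reroot_def)
  with steps_root_extension_reroot[OF G d] show ?thesis by (rule rtranclp.rtrancl_into_rtrancl)
qed

text \<open>The same operation is performed on the extension; the pendant edge takes no part in it,
  apart from following the root when a contraction renames it.\<close>

lemma step_root_extension:
  assumes "minor_step H F" and H: "rooted_graph H" and i: "i \<notin> verts H"
  shows "minor_step (root_extension i H) (root_extension i F)"
  using assms(1)
proof cases
  case (delete_edge e)
  have "i \<notin> e" using delete_edge H i by (auto simp: rooted_graph_def)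
  then have "insert {i, root H} (edges H) - {e} = insert {i, root H} (edges H - {e})" by auto
  moreover have "minor_step (root_extension i H) \<lparr>verts = verts (root_extension i H), edges = edges (root_extension i H) - {e}, root = root (root_extension i H)\<rparr>"
    using delete_edge by (intro minor_step.delete_edge) (auto simp: root_extension_def)
  ultimately show ?thesis using delete_edge by (simp add: root_extension_def)
next
  case (delete_vertex v)
  have vi: "v \<noteq> i" using delete_vertex i by auto
  have "minor_step (root_extension i H) \<lparr>verts = verts (root_extension i H) - {v}, edges = {e \<in> edges (root_extension i H). v \<notin> e}, root = root (root_extension i H)\<rparr>"
    using delete_vertex vi by (intro minor_step.delete_vertex) (auto simp: root_extension_def)
  moreover have "{e \<in> insert {i, root H} (edges H). v \<notin> e} = insert {i, root H} {e \<in> edges H. v \<notin> e}"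
    using vi delete_vertex by auto
  moreover have "insert i (verts H) - {v} = insert i (verts H - {v})" using vi by auto
  ultimately show ?thesis using delete_vertex by (simp add: root_extension_def)
next
  case (contract_edge u v)
  have uv: "u \<noteq> i" "v \<noteq> i" using edge_verts[OF H contract_edge(2)] i by auto
  have "minor_step (root_extension i H) \<lparr>verts = verts (root_extension i H) - {v},
    edges = {contract_map u v ` e | e. e \<in> edges (root_extension i H) \<and> e \<noteq> {u, v}},
    root = contract_map u v (root (root_extension i H))\<rparr>"
    using contract_edge by (intro minor_step.contract_edge) (auto simp: root_extension_def)
  moreover have "{contract_map u v ` e | e. e \<in> edges (root_extension i H) \<and> e \<noteq> {u, v}} =
    insert {i, contract_map u v (root H)} {contract_map u v ` e | e. e \<in> edges H \<and> e \<noteq> {u, v}}"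
  proof -
    have "contract_map u v ` {i, root H} = {i, contract_map u v (root H)}" using uv by (simp add: contract_map_def)
    moreover have "{i, root H} \<noteq> {u, v}" using uv by auto
    moreover have "{f e | e. e \<in> insert a E \<and> e \<noteq> b} = insert (f a) {f e | e. e \<in> E \<and> e \<noteq> b}"
      if "a \<noteq> b" for a b E and f :: "'a set \<Rightarrow> 'a set" using that by auto
    ultimately show ?thesis by (simp add: root_extension_def)
  qed
  moreover have "contract_map u v i = i" using uv by (simp add: contract_map_def)
  moreover have "insert i (verts H) - {v} = insert i (verts H - {v})" using uv by auto
  ultimately show ?thesis using contract_edge by (simp add: root_extension_def)
qed

lemma steps_root_extension:
  assumes "minor_step\<^sup>*\<^sup>* H F" and H: "rooted_graph H" and i: "i \<notin> verts H"
  shows "minor_step\<^sup>*\<^sup>* (root_extension i H) (root_extension i F)"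
  using assms(1)
proof (induction rule: rtranclp_induct)
  case (step F F')
  have "minor_step (root_extension i F) (root_extension i F')"
    using step_root_extension[OF step(2)] rooted_graph_steps[OF step(1) H] verts_steps[OF step(1)] i by blast
  then show ?case using step.IH by auto
qed simp

text \<open>The substantial case is the contraction of an edge from the root to \<open>z\<close>:
  then \<open>F\<close> without its root is \<open>G\<close> without its root and \<open>z\<close>,
  and the neighbour \<open>d\<close> of the merged root was a neighbour of the old root or of
  \<open>z\<close>.\<close>

lemma reroot_step:
  assumes st: "minor_step G F" and G: "rooted_graph G" and d: "{root F, d} \<in> edges F"
  shows "\<exists>e. {root G, e} \<in> edges G \<and> minor_step\<^sup>*\<^sup>* (reroot G e) (reroot F d)"
  using st
proof cases
  case (delete_edge f)
  have dG: "{root G, d} \<in> edges G" using d delete_edge by simp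
  show ?thesis
  proof (cases "root G \<in> f")
    case True
    then have "reroot F d = reroot G d" using delete_edge by (auto simp: reroot_def)
    then show ?thesis using dG by auto
  next
    case False
    have "minor_step (reroot G d) \<lparr>verts = verts (reroot G d), edges = edges (reroot G d) - {f}, root = root (reroot G d)\<rparr>"
      using False delete_edge by (intro minor_step.delete_edge) (auto simp: reroot_def)
    moreover have "\<lparr>verts = verts (reroot G d), edges = edges (reroot G d) - {f}, root = root (reroot G d)\<rparr> = reroot F d"
      using delete_edge by (auto simp: reroot_def)
    ultimately show ?thesis using dG by auto
  qed
next
  case (delete_vertex v)
  have dG: "{root G, d} \<in> edges G" "v \<noteq> d" using d delete_vertex by auto
  have "minor_step (reroot G d) \<lparr>verts = verts (reroot G d) - {v}, edges = {e \<in> edges (reroot G d). v \<notin> e}, root = root (reroot G d)\<rparr>"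
    using dG delete_vertex by (intro minor_step.delete_vertex) (auto simp: reroot_def)
  moreover have "\<lparr>verts = verts (reroot G d) - {v}, edges = {e \<in> edges (reroot G d). v \<notin> e}, root = root (reroot G d)\<rparr> = reroot F d"
    using delete_vertex by (auto simp: reroot_def)
  ultimately show ?thesis using dG by auto
next
  case (contract_edge u v)
  let ?c = "contract_map u v"
  have F: "rooted_graph F" by (rule rooted_graph_step[OF st G])
  have dF: "d \<noteq> root F" "d \<in> verts F" using edge_verts[OF F d] by auto
  have dv: "d \<noteq> v" using dF contract_edge by auto
  obtain e where e: "e \<in> edges G" "e \<noteq> {u, v}" "{root F, d} = ?c ` e" using d contract_edge by auto
  show ?thesis
  proof (cases "root G = u \<or> root G = v")
    case False
    then have rF: "root F = root G" using contract_edge by (simp add: contract_map_def)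
    then have "root G \<in> ?c ` e" using e(3) by auto
    then have "root G \<in> e" using False by (auto simp: contract_map_def split: if_splits)
    then obtain x where x: "e = {root G, x}" "root G \<noteq> x" using edge_doubleton[OF G e(1)] by blast
    have "?c (root G) = root G" using False by (simp add: contract_map_def)
    then have cx: "?c x = d" using e(3) x rF dF by auto
    have "minor_step (reroot G x) \<lparr>verts = verts (reroot G x) - {v},
      edges = {?c ` e | e. e \<in> edges (reroot G x) \<and> e \<noteq> {u, v}}, root = ?c (root (reroot G x))\<rparr>"
      using contract_edge False by (intro minor_step.contract_edge) (auto simp: reroot_def)
    moreover have "{?c ` e | e. e \<in> edges (reroot G x) \<and> e \<noteq> {u, v}} = edges (reroot F d)"
    proof -
      have "root G \<in> ?c ` e \<longleftrightarrow> root G \<in> e" for e using False by (auto simp: contract_map_def image_iff)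
      then show ?thesis using contract_edge rF by (auto simp: reroot_def)
    qed
    moreover have "verts (reroot G x) - {v} = verts (reroot F d)" using contract_edge rF by (auto simp: reroot_def)
    moreover have "?c (root (reroot G x)) = root (reroot F d)" using cx by (simp add: reroot_def)
    ultimately have "minor_step (reroot G x) (reroot F d)" by simp
    then show ?thesis using e x by auto
  next
    case True
    define z where "z = (if root G = u then v else u)"
    have z: "{root G, z} = {u, v}" "z \<noteq> root G" using True contract_edge by (auto simp: z_def)
    have rF: "root F = u" using True contract_edge by (auto simp: contract_map_def)
    have du: "d \<noteq> u" using dF rF by simp
    have "d \<in> ?c ` e" using e(3) by auto
    then have "d \<in> e" using du by (auto simp: contract_map_def split: if_splits)
    then obtain y where y: "e = {d, y}" "d \<noteq> y" using edge_doubleton[OF G e(1)] by blast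
    have "u \<in> ?c ` e" using e(3) rF by auto
    then have "y = u \<or> y = v" using y dv du by (auto simp: contract_map_def split: if_splits)
    then have y': "y = root G \<or> y = z" using z by auto
    have dz: "d \<noteq> z" "d \<noteq> root G" using du dv z True by (auto simp: z_def)
    have vz: "z \<in> verts G" using edge_verts[OF G] contract_edge(2) z(1) by metis
    have avoid: "{e \<in> edges F. u \<notin> e} = {e \<in> edges G. u \<notin> e \<and> v \<notin> e}"
    proof -
      have mem: "u \<in> ?c ` e \<longleftrightarrow> u \<in> e \<or> v \<in> e" for e by (auto simp: contract_map_def image_iff)
      have EF: "edges F = {?c ` e | e. e \<in> edges G \<and> e \<noteq> {u, v}}" using contract_edge by simp
      show ?thesis
      proof (intro equalityI subsetI)
        fix f assume "f \<in> {e \<in> edges F. u \<notin> e}"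
        then obtain e where e: "e \<in> edges G" "f = ?c ` e" "u \<notin> f" unfolding EF by blast
        then have ue: "u \<notin> e" "v \<notin> e" using mem by auto
        have "f = e" unfolding e(2) by (rule contract_map_id[OF ue(2)])
        then show "f \<in> {e \<in> edges G. u \<notin> e \<and> v \<notin> e}" using ue e(1) by simp
      next
        fix f assume f: "f \<in> {e \<in> edges G. u \<notin> e \<and> v \<notin> e}"
        then have "?c ` f = f" by (simp add: contract_map_id)
        moreover have "f \<noteq> {u, v}" using f by blast
        ultimately show "f \<in> {e \<in> edges F. u \<notin> e}" unfolding EF using f
          by (intro CollectI conjI exI[of _ f]) auto
      qed
    qed
    have RF: "reroot F d = \<lparr>verts = verts G - {root G} - {z}, edges = {e \<in> edges G. root G \<notin> e \<and> z \<notin> e}, root = d\<rparr>"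
    proof -
      have "(u \<notin> e \<and> v \<notin> e) = (root G \<notin> e \<and> z \<notin> e)" for e using True by (auto simp: z_def)
      moreover have "verts F - {u} = verts G - {root G} - {z}" using contract_edge True by (auto simp: z_def)
      ultimately show ?thesis using avoid rF by (simp add: reroot_def)
    qed
    show ?thesis
    \<comment> \<open>If \<open>d\<close> was adjacent to the old root, reroot at \<open>d\<close>
      and delete \<open>z\<close>. Otherwise reroot at \<open>z\<close>, to which \<open>d\<close>
      is adjacent, and reroot once more at \<open>d\<close>.\<close>
    proof (cases "y = root G")
      case True
      then have dG: "{root G, d} \<in> edges G" using e(1) y by (simp add: insert_commute)
      have "minor_step (reroot G d) \<lparr>verts = verts (reroot G d) - {z}, edges = {e \<in> edges (reroot G d). z \<notin> e}, root = root (reroot G d)\<rparr>"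
        using dz z vz by (intro minor_step.delete_vertex) (auto simp: reroot_def)
      moreover have "\<lparr>verts = verts (reroot G d) - {z}, edges = {e \<in> edges (reroot G d). z \<notin> e}, root = root (reroot G d)\<rparr> = reroot F d"
        unfolding RF by (auto simp: reroot_def)
      ultimately show ?thesis using dG by auto
    next
      case False
      then have yz: "y = z" using y' by simp
      have zG: "{root G, z} \<in> edges G" using contract_edge(2) z(1) by simp
      have R: "rooted_graph (reroot G z)" by (rule rooted_graph_reroot[OF G zG])
      have "{root (reroot G z), d} \<in> edges (reroot G z)"
        using e(1) y yz dz z by (auto simp: reroot_def insert_commute)
      from steps_reroot[OF R this] have "minor_step\<^sup>*\<^sup>* (reroot G z) (reroot (reroot G z) d)" .
      moreover have "reroot (reroot G z) d = reroot F d" unfolding RF by (auto simp: reroot_def)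
      ultimately show ?thesis using zG by auto
    qed
  qed
qed

lemma reroot_steps:
  assumes "minor_step\<^sup>*\<^sup>* G F" and G: "rooted_graph G" and "{root F, d} \<in> edges F"
  shows "\<exists>e. {root G, e} \<in> edges G \<and> minor_step\<^sup>*\<^sup>* (reroot G e) (reroot F d)"
  using assms(1,3)
proof (induction arbitrary: d rule: rtranclp_induct)
  case (step F F')
  obtain d' where d': "{root F, d'} \<in> edges F" "minor_step\<^sup>*\<^sup>* (reroot F d') (reroot F' d)"
    using reroot_step[OF step.hyps(2) rooted_graph_steps[OF step.hyps(1) G] step.prems] by blast
  obtain e where "{root G, e} \<in> edges G" "minor_step\<^sup>*\<^sup>* (reroot G e) (reroot F d')"
    using step.IH[OF d'(1)] by blast
  then show ?case using d'(2) by (meson rtranclp_trans)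
qed auto

lemma rooted_iso_reroot:
  assumes iso: "rooted_iso F' F" and F': "rooted_graph F'" and d: "{root F, d} \<in> edges F"
  shows "\<exists>d'. {root F', d'} \<in> edges F' \<and> rooted_iso (reroot F' d') (reroot F d)"
proof -
  obtain f where f: "bij_betw f (verts F') (verts F)" "edges F = (\<lambda>e. f ` e) ` edges F'" "f (root F') = root F"
    using iso by (auto simp: rooted_iso_def)
  have inj: "inj_on f (verts F')" using f(1) by (simp add: bij_betw_def)
  have r: "root F' \<in> verts F'" using F' by (simp add: rooted_graph_def)
  have mem: "root F \<in> f ` e \<longleftrightarrow> root F' \<in> e" if "e \<in> edges F'" for e
    unfolding f(3)[symmetric] using F' that by (intro inj_on_image_mem_iff[OF inj r]) (auto simp: rooted_graph_def)
  have F: "rooted_graph F" using rooted_iso_imp(1)[OF iso F'] .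
  obtain e where e: "e \<in> edges F'" "{root F, d} = f ` e" using d f(2) by auto
  then have "root F' \<in> e" using mem by auto
  then obtain d' where d': "e = {root F', d'}" "root F' \<noteq> d'" using edge_doubleton[OF F' e(1)] by blast
  have "f d' = d" using e(2) d' f(3) edge_verts[OF F d] by (auto simp: doubleton_eq_iff)
  moreover have "bij_betw f (verts F' - {root F'}) (verts F - {root F})"
    using bij_betw_DiffI[OF f(1), of "{root F'}" "{root F}"] r f(3) F
    by (simp add: rooted_graph_def)
  moreover have "{e \<in> edges F. root F \<notin> e} = (\<lambda>e. f ` e) ` {e \<in> edges F'. root F' \<notin> e}"
    unfolding f(2) using mem by auto
  ultimately have "rooted_iso (reroot F' d') (reroot F d)"
    unfolding rooted_iso_def by (intro exI[of _ f]) (simp add: reroot_def)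
  then show ?thesis using e(1) d' by auto
qed

text \<open>A copy \<open>F\<close> of \<open>F'\<close> may itself use the name \<open>i\<close>,
  so each side gets a new vertex of its own.\<close>

lemma rooted_iso_root_extension:
  assumes iso: "rooted_iso F' F" and F': "rooted_graph F'" and i: "i \<notin> verts F'" and x: "x \<notin> verts F"
  shows "rooted_iso (root_extension i F') (root_extension x F)"
proof -
  obtain f where f: "bij_betw f (verts F') (verts F)" "edges F = (\<lambda>e. f ` e) ` edges F'" "f (root F') = root F"
    using iso by (auto simp: rooted_iso_def)
  define g where "g = f(i := x)"
  have gf: "g v = f v" if "v \<in> verts F'" for v using that i by (auto simp: g_def)
  have "bij_betw g (verts F') (verts F)" using f(1) gf bij_betw_cong by metis
  then have "bij_betw g (insert i (verts F')) (insert x (verts F))"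
    using i x notIn_Un_bij_betw[of i "verts F'" g "verts F"] by (simp add: g_def)
  moreover have "g ` e = f ` e" if "e \<in> edges F'" for e
    using F' that gf by (intro image_cong) (auto simp: rooted_graph_def)
  then have "(\<lambda>e. g ` e) ` edges F' = edges F" unfolding f(2) by (rule image_cong[OF refl])
  moreover have "g ` {i, root F'} = {x, root F}"
    using gf[of "root F'"] f(3) F' by (auto simp: g_def rooted_graph_def)
  ultimately show ?thesis
    unfolding rooted_iso_def by (intro exI[of _ g]) (simp add: root_extension_def g_def)
qed

section \<open>Transfer of minimality\<close>

lemma proper_rooted_minorI:
  assumes "minor_step\<^sup>*\<^sup>* G F'" "rooted_iso F' F" "rooted_graph G" "graph_size F' < graph_size G"
  shows "proper_rooted_minor F G"
proof -
  have "rooted_graph F'" using rooted_graph_steps assms by blast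
  then have F: "rooted_graph F" "graph_size F = graph_size F'" using rooted_iso_imp assms(2) by blast+
  then have "\<not> rooted_iso F G" using rooted_iso_imp(2)[of F G] assms(4) by auto
  then show ?thesis using assms by (auto simp: proper_rooted_minor_def rooted_minor_def)
qed

text \<open>An even value that is at least \<open>2 * k + 1\<close> is at least
  \<open>2 * k + 2\<close>, which pays for the loss of one in the perturbation.\<close>

lemma odd_xixi_allows:
  assumes G: "rooted_graph G" and s: "2 * k + 1 \<le> xixi G"
  shows "\<exists>m\<ge>k. allows_with_SNIP G m (Suc m)"
proof (cases rule: xixi_attained[OF G])
  case (1 m)
  then obtain m' where "m = Suc m'" "k \<le> m'" using s by (cases m) auto
  then show ?thesis using allows_equal_imp_parter_pair[OF G, of m'] 1 le_trans by blast
next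
  case (2 m)
  then show ?thesis using s by auto
qed

lemma extends_root_iff: "extends_root H G \<longleftrightarrow> root G \<notin> verts H \<and> G = root_extension (root G) H"
  by (cases G) (auto simp: extends_root_def root_extension_def)

text \<open>Minimality forces \<open>G\<close> to coincide with the root extension found inside it.
  A proper minor \<open>F\<close> of \<open>H\<close> with \<open>xixi F \<ge> 2 * k\<close> would
  produce a proper minor of \<open>G\<close> of value at least \<open>2 * k + 1\<close>: a root
  extension of \<open>F\<close> if \<open>xixi F\<close> is even, \<open>F\<close> itself if it is
  odd.\<close>

lemma minimal_odd_imp_extension:
  assumes min: "minimal_minor (2 * k + 1) G"
  shows "\<exists>H. minimal_minor (2 * k) H \<and> extends_root H G"
proof -
  have G: "rooted_graph G" "2 * k + 1 \<le> xixi G"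
    and lt: "\<And>F. proper_rooted_minor F G \<Longrightarrow> xixi F < 2 * k + 1"
    using min by (auto simp: minimal_minor_def)
  obtain m where m: "k \<le> m" "allows_with_SNIP G m (Suc m)" using odd_xixi_allows[OF G] by blast
  obtain d where d: "{root G, d} \<in> edges G" "allows_with_SNIP (reroot G d) m m"
    using allows_reroot[OF G(1) m(2)] by blast
  define i H where "i = root G" and "H = reroot G d"
  have H: "rooted_graph H" using rooted_graph_reroot[OF G(1) d(1)] by (simp add: H_def)
  have iH: "i \<notin> verts H" by (simp add: i_def H_def reroot_def)
  have st: "minor_step\<^sup>*\<^sup>* G (root_extension i H)"
    using steps_root_extension_reroot[OF G(1) d(1)] by (simp add: i_def H_def)
  have "root_extension i H = G"
  proof (rule ccontr)
    assume "root_extension i H \<noteq> G"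
    then have "graph_size (root_extension i H) < graph_size G" using graph_size_steps[OF st G(1)] by blast
    then have "proper_rooted_minor (root_extension i H) G"
      using proper_rooted_minorI[OF st rooted_iso_refl G(1)] by blast
    then have "xixi (root_extension i H) < 2 * k + 1" by (rule lt)
    moreover have "allows_with_SNIP (root_extension i H) m (Suc m)"
      using allows_root_extension[OF H iH] d(2) by (simp add: H_def)
    then have "m + Suc m \<le> xixi (root_extension i H)"
      by (intro le_xixi[OF rooted_graph_root_extension[OF H iH]]) auto
    ultimately show False using m(1) by linarith
  qed
  then have GH: "G = root_extension i H" by simp
  have sGH: "minor_step G H" unfolding GH by (rule step_contract_root_extension[OF H iH])
  have szG: "graph_size G = graph_size H + 2" unfolding GH by (rule graph_size_root_extension[OF H iH])
  have "xixi F < 2 * k" if F: "proper_rooted_minor F H" for F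
  proof (rule ccontr)
    assume "\<not> xixi F < 2 * k"
    then have ge: "2 * k \<le> xixi F" by simp
    obtain F' where F': "minor_step\<^sup>*\<^sup>* H F'" "rooted_iso F' F"
      using F by (auto simp: proper_rooted_minor_def rooted_minor_def)
    have rF': "rooted_graph F'" by (rule rooted_graph_steps[OF F'(1) H])
    have rF: "rooted_graph F" "card (verts F) = card (verts F')" using rooted_iso_imp[OF F'(2) rF'] by auto
    have "F' \<noteq> H" using F rooted_iso_sym[OF F'(2) rF'] by (auto simp: proper_rooted_minor_def)
    then have sz: "graph_size F' < graph_size H" using graph_size_steps[OF F'(1) H] by blast
    show False
    proof (cases rule: xixi_attained[OF rF(1)])
      case (1 p)
      have iF': "i \<notin> verts F'" using verts_steps[OF F'(1)] iH by blast
      \<comment> \<open>The vertex type may be finite. A vertex outside \<open>F\<close> exists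
        nevertheless: \<open>F'\<close> has as many vertices as \<open>F\<close> and misses
        \<open>i\<close>.\<close>
      have "\<exists>x. x \<notin> verts F"
      proof (rule ccontr)
        assume "\<not> ?thesis"
        then have U: "verts F = UNIV" by auto
        then have "finite (UNIV :: 'a set)" using rF(1) by (simp add: rooted_graph_def)
        then have "card (insert i (verts F')) \<le> card (verts F)" unfolding U by (intro card_mono) auto
        then show False using rF(2) iF' rF' by (simp add: rooted_graph_def)
      qed
      then obtain x where x: "x \<notin> verts F" by blast
      have "minor_step\<^sup>*\<^sup>* G (root_extension i F')" unfolding GH by (rule steps_root_extension[OF F'(1) H iH])
      moreover have "graph_size (root_extension i F') < graph_size G"
        using graph_size_root_extension[OF rF' iF'] szG sz by simp
      ultimately have "proper_rooted_minor (root_extension x F) G"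
        using proper_rooted_minorI rooted_iso_root_extension[OF F'(2) rF' iF' x] G(1) by blast
      then have "xixi (root_extension x F) < 2 * k + 1" by (rule lt)
      moreover have "p + Suc p \<le> xixi (root_extension x F)"
        by (intro le_xixi[OF rooted_graph_root_extension[OF rF(1) x] allows_root_extension[OF rF(1) x 1(1)]]) auto
      ultimately show False using 1(2) ge by linarith
    next
      case (2 p)
      have "minor_step\<^sup>*\<^sup>* G F'" using sGH F'(1) by (rule converse_rtranclp_into_rtranclp)
      then have "proper_rooted_minor F G" using proper_rooted_minorI[OF _ F'(2) G(1)] sz szG by simp
      then have "xixi F < 2 * k + 1" by (rule lt)
      then show False using 2(2) ge by presburger
    qed
  qed
  moreover have "2 * k \<le> xixi H" using le_xixi[OF H, of m m] d(2) m(1) by (simp add: H_def)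
  ultimately have "minimal_minor (2 * k) H" using H by (simp add: minimal_minor_def)
  moreover have "extends_root H G"
    unfolding extends_root_iff by (rule conjI[OF iH[unfolded i_def] GH[unfolded i_def]])
  ultimately show ?thesis by blast
qed

text \<open>An odd \<open>xixi H\<close> cannot occur, as rerooting \<open>H\<close> would give a
  proper minor of value at least \<open>2 * k\<close>. A proper minor of \<open>G\<close> of value
  at least \<open>2 * k + 1\<close> is excluded by rerooting it, which leads to a proper minor of
  \<open>H\<close>.\<close>

lemma extension_of_minimal_even:
  assumes min: "minimal_minor (2 * k) H" and ext: "extends_root H G"
  shows "minimal_minor (2 * k + 1) G"
proof -
  have H: "rooted_graph H" "2 * k \<le> xixi H"
    and lt: "\<And>F. proper_rooted_minor F H \<Longrightarrow> xixi F < 2 * k"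
    using min by (auto simp: minimal_minor_def)
  define i where "i = root G"
  have iH: "i \<notin> verts H" and GH: "G = root_extension i H" using ext unfolding extends_root_iff i_def by blast+
  have G: "rooted_graph G" unfolding GH by (rule rooted_graph_root_extension[OF H(1) iH])
  have szG: "graph_size G = graph_size H + 2" unfolding GH by (rule graph_size_root_extension[OF H(1) iH])
  have "2 * k + 1 \<le> xixi G"
  proof (cases rule: xixi_attained[OF H(1)])
    case (1 p)
    have "p + Suc p \<le> xixi G"
      using allows_root_extension[OF H(1) iH 1(1)] by (intro le_xixi[OF G]) (auto simp: GH)
    then show ?thesis using 1(2) H(2) by linarith
  next
    case (2 p)
    obtain d where d: "{root H, d} \<in> edges H" "allows_with_SNIP (reroot H d) p p"
      using allows_reroot[OF H(1) 2(1)] by blast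
    have R: "rooted_graph (reroot H d)" by (rule rooted_graph_reroot[OF H(1) d(1)])
    have st: "minor_step\<^sup>*\<^sup>* H (root_extension (root H) (reroot H d))" by (rule steps_root_extension_reroot[OF H(1) d(1)])
    have "graph_size (root_extension (root H) (reroot H d)) = graph_size (reroot H d) + 2"
      by (rule graph_size_root_extension[OF R]) (simp add: reroot_def)
    then have "graph_size (reroot H d) < graph_size H" using graph_size_steps[OF st H(1)] by auto
    then have "proper_rooted_minor (reroot H d) H"
      by (rule proper_rooted_minorI[OF steps_reroot[OF H(1) d(1)] rooted_iso_refl H(1)])
    then have "xixi (reroot H d) < 2 * k" by (rule lt)
    moreover have "p + p \<le> xixi (reroot H d)" by (rule le_xixi[OF R d(2)]) simp
    ultimately show ?thesis using 2(2) H(2) by presburger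
  qed
  moreover have "xixi F < 2 * k + 1" if F: "proper_rooted_minor F G" for F
  proof (rule ccontr)
    assume "\<not> xixi F < 2 * k + 1"
    then have ge: "2 * k + 1 \<le> xixi F" by simp
    obtain F' where F': "minor_step\<^sup>*\<^sup>* G F'" "rooted_iso F' F"
      using F by (auto simp: proper_rooted_minor_def rooted_minor_def)
    have rF': "rooted_graph F'" by (rule rooted_graph_steps[OF F'(1) G])
    have rF: "rooted_graph F" by (rule rooted_iso_imp[OF F'(2) rF'])
    have "F' \<noteq> G" using F rooted_iso_sym[OF F'(2) rF'] by (auto simp: proper_rooted_minor_def)
    then have sz: "graph_size F' < graph_size G" using graph_size_steps[OF F'(1) G] by blast
    obtain m where m: "k \<le> m" "allows_with_SNIP F m (Suc m)" using odd_xixi_allows[OF rF ge] by blast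
    obtain d where d: "{root F, d} \<in> edges F" "allows_with_SNIP (reroot F d) m m"
      using allows_reroot[OF rF m(2)] by blast
    obtain d' where d': "{root F', d'} \<in> edges F'" "rooted_iso (reroot F' d') (reroot F d)"
      using rooted_iso_reroot[OF F'(2) rF' d(1)] by blast
    obtain e where e: "{root G, e} \<in> edges G" "minor_step\<^sup>*\<^sup>* (reroot G e) (reroot F' d')"
      using reroot_steps[OF F'(1) G d'(1)] by blast
    have "e = root H" "reroot G e = H"
    proof -
      have E: "i \<notin> f" if "f \<in> edges H" for f using H(1) iH that by (auto simp: rooted_graph_def)
      then have "{i, e} = {i, root H}" using e(1) by (auto simp: GH root_extension_def)
      then show "e = root H" by (auto simp: doubleton_eq_iff)
      have "{f \<in> insert {i, root H} (edges H). i \<notin> f} = edges H" using E by auto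
      moreover have "insert i (verts H) - {i} = verts H" using iH by auto
      ultimately show "reroot G e = H" using \<open>e = root H\<close> by (simp add: GH reroot_def root_extension_def)
    qed
    then have st: "minor_step\<^sup>*\<^sup>* H (reroot F' d')" using e(2) by simp
    \<comment> \<open>Rerooting at a neighbour removes at least one vertex and one edge, hence
      lowers the size by at least 2. As \<open>G\<close> exceeds \<open>H\<close> by exactly 2, the
      strict drop from \<open>G\<close> to \<open>F'\<close> carries over to
      \<open>H\<close>.\<close>
    have "graph_size (root_extension (root F') (reroot F' d')) = graph_size (reroot F' d') + 2"
      by (rule graph_size_root_extension[OF rooted_graph_reroot[OF rF' d'(1)]]) (simp add: reroot_def)
    then have "graph_size (reroot F' d') + 2 \<le> graph_size F'"
      using graph_size_steps[OF steps_root_extension_reroot[OF rF' d'(1)] rF'] by auto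
    then have "graph_size (reroot F' d') < graph_size H" using sz szG by simp
    then have "proper_rooted_minor (reroot F d) H" by (rule proper_rooted_minorI[OF st d'(2) H(1)])
    then have "xixi (reroot F d) < 2 * k" by (rule lt)
    moreover have "m + m \<le> xixi (reroot F d)" by (rule le_xixi[OF rooted_graph_reroot[OF rF d(1)] d(2)]) simp
    ultimately show False using m(1) by linarith
  qed
  ultimately show ?thesis using G by (simp add: minimal_minor_def)
qed

theorem theorem4p4:
  fixes k :: nat
  shows "{G :: 'a rooted_graph. minimal_minor (2 * k + 1) G} =
         {G. \<exists>H. minimal_minor (2 * k) H \<and> extends_root H G}"
  using minimal_odd_imp_extension extension_of_minimal_even by blast

end
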